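(* Let $M$ be a Lorentzian hypersurface in $\mathbb E^5_1$ whose shape operator $S$ is given, with respect to a pseudo-orthonormal frame field $\{e_1,e_2,e_3,e_4\}$ on $M$, by $$Se_1=k_1e_1-e_3,\quad Se_2=k_1e_2,\quad Se_3=e_2+k_1e_3,\quad Se_4=k_4e_4$$ for some smooth functions $k_1,k_4$ on $M$. Then $M$ is biharmonic if and only if it is minimal.
   Context: $\mathbb E^5_1$ is Minkowski 5-space, i.e. $\mathbb R^5$ with the metric $-dx_1^2+dx_2^2+dx_3^2+dx_4^2+dx_5^2$, with inner product $\langle\cdot,\cdot\rangle$. A Lorentzian hypersurface $M$ is a smooth, connected, oriented 4-dimensional manifold with an isometric immersion $x:M\to\mathbb E^5_1$ whose induced metric has index 1. Let $N$ be the unit normal field given by the orientation; the shape operator $S$ is defined by $SX=-\widetilde\nabla_X N$, where $\widetilde\nabla$ is the flat connection of $\mathbb E^5_1$. A pseudo-orthonormal frame field $\{e_1,e_2,e_3,e_4\}$ is a smooth tangent frame with $\langle e_1,e_1\rangle=\langle e_2,e_2\rangle=0$, $\langle e_1,e_2\rangle=-1$, $\langle e_A,e_a\rangle=0$ and $\langle e_a,e_b\rangle=\delta_{ab}$ for $A\in\{1,2\}$, $a,b\in\{3,4\}$. The (first) mean curvature is $s_1=\mathrm{tr}\,S$; here $s_1=3k_1+k_4$. $M$ is minimal if $s_1=0$ identically. $M$ is biharmonic if $\Delta^2x=0$, where $\Delta$ is the Laplace operator of $M$ (with the sign convention $\Delta=-\mathrm{div}\,\nabla$) applied componentwise to $x$.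 Equivalently, $M$ is biharmonic if and only if $S(\nabla s_1)+\frac{s_1}{2}\nabla s_1=0$ and $\Delta s_1+s_1\,\mathrm{tr}\,S^2=0$, where $\nabla s_1$ is the gradient of $s_1$. *)

theory Defs
  imports "HOL-Analysis.Analysis"
begin

section \<open>Smooth maps between open subsets of normed spaces\<close>

primrec Ck_on :: "nat \<Rightarrow> ('a::real_normed_vector \<Rightarrow> 'b::real_normed_vector) \<Rightarrow> 'a set \<Rightarrow> bool" where
  "Ck_on 0 f W \<longleftrightarrow> continuous_on W f"
| "Ck_on (Suc k) f W \<longleftrightarrow>
     (\<forall>y\<in>W. f differentiable at y) \<and> (\<forall>v. Ck_on k (\<lambda>y. frechet_derivative f (at y) v) W)"

definition smooth_on :: "('a::real_normed_vector \<Rightarrow> 'b::real_normed_vector) \<Rightarrow> 'a set \<Rightarrow> bool" where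
  "smooth_on f W \<longleftrightarrow> (\<forall>k. Ck_on k f W)"


section \<open>Oriented smooth 4-manifolds\<close>

type_synonym 'm chart = "'m set \<times> ('m \<Rightarrow> real^4)"

definition is_chart :: "'m topology \<Rightarrow> 'm chart \<Rightarrow> bool" where
  "is_chart X c \<longleftrightarrow>
     openin X (fst c) \<and> open (snd c ` fst c) \<and>
     homeomorphic_map (subtopology X (fst c)) (top_of_set (snd c ` fst c)) (snd c)"

definition in_chart :: "'m chart \<Rightarrow> ('m \<Rightarrow> 'b) \<Rightarrow> real^4 \<Rightarrow> 'b" where
  "in_chart c f = f \<circ> inv_into (fst c) (snd c)"

text \<open>The orientation of the manifold is the one given by the atlas, whose transition maps all have
  positive Jacobian determinant; the atlas need not be maximal.\<close>

definition oriented_atlas :: "'m topology \<Rightarrow> 'm chart set \<Rightarrow> bool" where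
  "oriented_atlas X A \<longleftrightarrow>
     (\<forall>c\<in>A. is_chart X c) \<and> (\<Union>c\<in>A. fst c) = topspace X \<and>
     (\<forall>c\<in>A. \<forall>d\<in>A.
        smooth_on (in_chart c (snd d)) (snd c ` (fst c \<inter> fst d)) \<and>
        (\<forall>y\<in>snd c ` (fst c \<inter> fst d). det (jacobian (in_chart c (snd d)) (at y)) > 0))"

definition connected_oriented_manifold :: "'m topology \<Rightarrow> 'm chart set \<Rightarrow> bool" where
  "connected_oriented_manifold X A \<longleftrightarrow>
     Hausdorff_space X \<and> second_countable X \<and> connected_space X \<and> oriented_atlas X A"

definition smooth_map :: "'m chart set \<Rightarrow> ('m \<Rightarrow> 'b::real_normed_vector) \<Rightarrow> bool" where
  "smooth_map A f \<longleftrightarrow> (\<forall>c\<in>A. smooth_on (in_chart c f) (snd c ` fst c))"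

text \<open>The notions below that take a chart \<open>c\<close> and a point \<open>p\<close> are meant for \<open>p \<in> fst c\<close>; tangent
  vectors at \<open>p\<close> are there given by their components in \<open>real^4\<close> with respect to the coordinate
  basis of \<open>c\<close>.\<close>

definition differential :: "'m chart \<Rightarrow> ('m \<Rightarrow> 'b::real_normed_vector) \<Rightarrow> 'm \<Rightarrow> real^4 \<Rightarrow> 'b" where
  "differential c f p = frechet_derivative (in_chart c f) (at (snd c p))"

definition partial :: "'m chart \<Rightarrow> 4 \<Rightarrow> ('m \<Rightarrow> 'b::real_normed_vector) \<Rightarrow> 'm \<Rightarrow> 'b" where
  "partial c i f p = differential c f p (axis i 1)"


section \<open>Lorentzian hypersurfaces of Minkowski 5-space\<close>

definition mink :: "real^5 \<Rightarrow> real^5 \<Rightarrow> real" where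
  "mink u v = - (u$1 * v$1) + u$2 * v$2 + u$3 * v$3 + u$4 * v$4 + u$5 * v$5"

definition nondegenerate :: "('a::euclidean_space \<Rightarrow> 'a \<Rightarrow> real) \<Rightarrow> bool" where
  "nondegenerate B \<longleftrightarrow> (\<forall>v. (\<forall>w. B v w = 0) \<longrightarrow> v = 0)"

definition form_index :: "('a::euclidean_space \<Rightarrow> 'a \<Rightarrow> real) \<Rightarrow> nat" where
  "form_index B = Max (dim ` {W. subspace W \<and> (\<forall>v\<in>W. v \<noteq> 0 \<longrightarrow> B v v < 0)})"

definition first_form :: "'m chart \<Rightarrow> ('m \<Rightarrow> real^5) \<Rightarrow> 'm \<Rightarrow> real^4 \<Rightarrow> real^4 \<Rightarrow> real" where
  "first_form c x p v w = mink (differential c x p v) (differential c x p w)"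

definition lorentzian_hypersurface ::
    "'m topology \<Rightarrow> 'm chart set \<Rightarrow> ('m \<Rightarrow> real^5) \<Rightarrow> bool" where
  "lorentzian_hypersurface X A x \<longleftrightarrow>
     connected_oriented_manifold X A \<and> smooth_map A x \<and>
     (\<forall>c\<in>A. \<forall>p\<in>fst c.
        inj (differential c x p) \<and>
        nondegenerate (first_form c x p) \<and> form_index (first_form c x p) = 1)"

text \<open>Tangent vectors of the hypersurface are identified with their images under the
  differential of the immersion \<open>x\<close>.\<close>

definition tangent_space :: "'m chart \<Rightarrow> ('m \<Rightarrow> real^5) \<Rightarrow> 'm \<Rightarrow> (real^5) set" where
  "tangent_space c x p = range (differential c x p)"

definition components :: "'m chart \<Rightarrow> ('m \<Rightarrow> real^5) \<Rightarrow> 'm \<Rightarrow> real^5 \<Rightarrow> real^4" where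
  "components c x p Z = (THE v. differential c x p v = Z)"

text \<open>The sign of the normal is the one for which \<open>N\<close> followed by a positively oriented
  tangent basis is a positively oriented basis of \<open>real^5\<close>.\<close>

definition unit_normal_field :: "'m chart set \<Rightarrow> ('m \<Rightarrow> real^5) \<Rightarrow> ('m \<Rightarrow> real^5) \<Rightarrow> bool" where
  "unit_normal_field A x N \<longleftrightarrow>
     smooth_map A N \<and>
     (\<forall>c\<in>A. \<forall>p\<in>fst c.
        mink (N p) (N p) = 1 \<and>
        (\<forall>Z\<in>tangent_space c x p. mink (N p) Z = 0) \<and>
        det (vector [N p, partial c 1 x p, partial c 2 x p, partial c 3 x p, partial c 4 x p]
             :: real^5^5) > 0)"

text \<open>The derivative of \<open>F\<close> along \<open>Z\<close> with respect to the flat connection, for \<open>Z\<close> in the tangent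
  space at \<open>p\<close>.\<close>

definition flat_deriv ::
    "'m chart \<Rightarrow> ('m \<Rightarrow> real^5) \<Rightarrow> ('m \<Rightarrow> real^5) \<Rightarrow> 'm \<Rightarrow> real^5 \<Rightarrow> real^5" where
  "flat_deriv c x F p Z = differential c F p (components c x p Z)"

definition shape_operator ::
    "'m chart \<Rightarrow> ('m \<Rightarrow> real^5) \<Rightarrow> ('m \<Rightarrow> real^5) \<Rightarrow> 'm \<Rightarrow> real^5 \<Rightarrow> real^5" where
  "shape_operator c x N p Z = - flat_deriv c x N p Z"

text \<open>\<open>tr S\<close>, computed in the coordinate basis of the tangent space.\<close>

definition mean_curvature :: "'m chart \<Rightarrow> ('m \<Rightarrow> real^5) \<Rightarrow> ('m \<Rightarrow> real^5) \<Rightarrow> 'm \<Rightarrow> real" where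
  "mean_curvature c x N p =
     trace (matrix (\<lambda>v. components c x p (shape_operator c x N p (differential c x p v))))"

definition minimal_hypersurface ::
    "'m chart set \<Rightarrow> ('m \<Rightarrow> real^5) \<Rightarrow> ('m \<Rightarrow> real^5) \<Rightarrow> bool" where
  "minimal_hypersurface A x N \<longleftrightarrow> (\<forall>c\<in>A. \<forall>p\<in>fst c. mean_curvature c x N p = 0)"

definition pseudo_orthonormal_frame ::
    "'m chart set \<Rightarrow> ('m \<Rightarrow> real^5) \<Rightarrow> (4 \<Rightarrow> 'm \<Rightarrow> real^5) \<Rightarrow> bool" where
  "pseudo_orthonormal_frame A x e \<longleftrightarrow>
     (\<forall>i. smooth_map A (e i)) \<and>
     (\<forall>c\<in>A. \<forall>p\<in>fst c.
        (\<forall>i. e i p \<in> tangent_space c x p) \<and>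
        mink (e 1 p) (e 1 p) = 0 \<and> mink (e 2 p) (e 2 p) = 0 \<and> mink (e 1 p) (e 2 p) = -1 \<and>
        (\<forall>a\<in>{1,2}. \<forall>b\<in>{3,4}. mink (e a p) (e b p) = 0) \<and>
        (\<forall>a\<in>{3,4}. \<forall>b\<in>{3,4}. mink (e a p) (e b p) = (if a = b then 1 else 0)))"


section \<open>The Laplace operator of the induced metric\<close>

definition metric :: "'m chart \<Rightarrow> ('m \<Rightarrow> real^5) \<Rightarrow> 'm \<Rightarrow> real^4^4" where
  "metric c x p = (\<chi> i j. mink (partial c i x p) (partial c j x p))"

text \<open>\<open>christoffel c x k i j\<close> is the symbol with upper index \<open>k\<close> and lower indices \<open>i\<close>, \<open>j\<close>.\<close>

definition christoffel :: "'m chart \<Rightarrow> ('m \<Rightarrow> real^5) \<Rightarrow> 4 \<Rightarrow> 4 \<Rightarrow> 4 \<Rightarrow> 'm \<Rightarrow> real" where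
  "christoffel c x k i j p =
     (\<Sum>l\<in>UNIV. matrix_inv (metric c x p) $ k $ l *
        (partial c i (\<lambda>q. metric c x q $ j $ l) p
         + partial c j (\<lambda>q. metric c x q $ i $ l) p
         - partial c l (\<lambda>q. metric c x q $ i $ j) p)) / 2"

definition gradient :: "'m chart \<Rightarrow> ('m \<Rightarrow> real^5) \<Rightarrow> ('m \<Rightarrow> real) \<Rightarrow> 'm \<Rightarrow> real^4" where
  "gradient c x f p = matrix_inv (metric c x p) *v (\<chi> j. partial c j f p)"

text \<open>The trace of the covariant derivative of \<open>V\<close> with respect to the Levi-Civita connection.\<close>

definition divergence :: "'m chart \<Rightarrow> ('m \<Rightarrow> real^5) \<Rightarrow> ('m \<Rightarrow> real^4) \<Rightarrow> 'm \<Rightarrow> real" where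
  "divergence c x V p =
     (\<Sum>i\<in>UNIV. partial c i (\<lambda>q. V q $ i) p + (\<Sum>j\<in>UNIV. christoffel c x i i j p * V p $ j))"

definition laplacian :: "'m chart \<Rightarrow> ('m \<Rightarrow> real^5) \<Rightarrow> ('m \<Rightarrow> real) \<Rightarrow> 'm \<Rightarrow> real" where
  "laplacian c x f p = - divergence c x (gradient c x f) p"

text \<open>The Laplace operator is local and independent of the chart, so \<open>\<Delta>\<^sup>2 x = 0\<close> is
  expressed in each chart of the atlas.\<close>

definition biharmonic :: "'m chart set \<Rightarrow> ('m \<Rightarrow> real^5) \<Rightarrow> bool" where
  "biharmonic A x \<longleftrightarrow>
     (\<forall>c\<in>A. \<forall>p\<in>fst c. \<forall>a. laplacian c x (laplacian c x (\<lambda>q. x q $ a)) p = 0)"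

end

theory Submission
  imports Defs
begin

text \<open>Write \<open>s = 3 k1 + k4\<close> for the trace of the shape operator \<open>S\<close>. In coordinates the
  Laplacian of the position vector is \<open>- s N\<close>, so a minimal hypersurface is biharmonic at once.

  For the converse, the normal and tangential parts of \<open>\<Delta> (s N) = 0\<close> are
  \<open>\<Delta> s + s tr S\<^sup>2 = 0\<close> and \<open>S (\<nabla>s) = - (s / 2) \<nabla>s\<close> (\<open>biharmonic_normal_tangential\<close>), where
  \<open>tr S\<^sup>2 = 3 k1\<^sup>2 + k4\<^sup>2\<close>. Suppose that \<open>s\<close> has a nonzero value somewhere. On the open set where
  \<open>s \<noteq> 0\<close> the gradient cannot vanish identically, for then the normal equation would give
  \<open>k1 = k4 = 0\<close>. Near a point where it does not vanish, \<open>- s / 2\<close> is an eigenvalue of \<open>S\<close> with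
  eigenvector \<open>\<nabla>s\<close>. The eigenvectors of \<open>S\<close> are the multiples of \<open>e2\<close> (eigenvalue \<open>k1\<close>) and of
  \<open>e4\<close> (eigenvalue \<open>k4\<close>), and the two eigenvalues cannot both be \<open>- s / 2\<close> when \<open>s \<noteq> 0\<close>; so one of
  two cases holds on a whole neighbourhood.

  If \<open>\<nabla>s\<close> is a multiple of the null vector \<open>e2\<close>, then \<open>k4 = - 5 k1\<close>. The Codazzi equations and
  the commutators of the frame applied to \<open>k1\<close> make so many connection coefficients vanish that the
  curvature component \<open>\<langle>R(e1, e4) e2, e4\<rangle>\<close> is zero, whereas the Gauss equation evaluates it to
  \<open>k1 k4 = - 5 k1\<^sup>2 \<noteq> 0\<close> (\<open>null_gradient_impossible\<close>).

  If \<open>\<nabla>s\<close> is a multiple of \<open>e4\<close>, then \<open>k4 = - k1\<close>. With \<open>a = \<langle>\<nabla>\<^sub>e\<^sub>3 e3, e4\<rangle>\<close>, the Codazzi equations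
  give \<open>e4 k1 = 2 k1 a\<close> and one Gauss equation gives \<open>e4 a = a\<^sup>2 - k1\<^sup>2\<close>; the normal biharmonic
  equation then becomes \<open>- 2 k1\<^sup>3 = 4 k1\<^sup>3\<close> (\<open>spacelike_gradient_impossible\<close>).

  All computations take place in a single chart and use only the flat derivatives \<open>D i\<close> of ambient
  vector-valued functions along the frame. The structure equations of the hypersurface then all come
  from one fact, \<open>commutator\<close>: the bracket of two such derivations is again a combination of
  them, with coefficients read off from the derivatives of the frame. Applied to the normal it yields the
  Codazzi equation, and applied to a frame vector the Gauss equation.\<close>

section \<open>Calculus of smooth functions on open sets\<close>

lemma has_frechet_derivative:
  "f differentiable F \<Longrightarrow> (f has_derivative frechet_derivative f F) F"
  by (simp add: frechet_derivative_works)

lemma frechet_derivative_cong_open: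
  assumes "open W" "y \<in> W" "\<And>z. z \<in> W \<Longrightarrow> f z = g z"
  shows "frechet_derivative f (at y) = frechet_derivative g (at y)"
proof -
  have "(f has_derivative f') (at y) \<longleftrightarrow> (g has_derivative f') (at y)" for f'
    using has_derivative_transform_within_open[OF _ assms(1,2)] assms(3) by metis
  then show ?thesis
    by (simp add: frechet_derivative_def)
qed

lemma differentiable_cong_open:
  assumes "open W" "y \<in> W" "\<And>z. z \<in> W \<Longrightarrow> f z = g z"
  shows "f differentiable at y \<longleftrightarrow> g differentiable at y"
  using has_derivative_transform_within_open[OF _ assms(1,2)] assms(3)
  unfolding differentiable_def by metis

lemma Ck_on_cong:
  assumes "open W" "\<And>z. z \<in> W \<Longrightarrow> f z = g z"
  shows "Ck_on k f W \<longleftrightarrow> Ck_on k g W"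
  using assms(2)
proof (induction k arbitrary: f g)
  case 0
  then show ?case by (auto intro: continuous_on_cong)
next
  case (Suc k)
  have "Ck_on k (\<lambda>y. frechet_derivative f (at y) v) W \<longleftrightarrow>
        Ck_on k (\<lambda>y. frechet_derivative g (at y) v) W" for v
    by (rule Suc.IH) (rule arg_cong[where f = "\<lambda>h. h v"],
      rule frechet_derivative_cong_open[OF assms(1) _ Suc.prems])
  then show ?case
    using differentiable_cong_open[OF assms(1) _ Suc.prems] by auto
qed

lemma Ck_on_SucD: "Ck_on (Suc k) f W \<Longrightarrow> Ck_on k f W"
proof (induction k arbitrary: f)
  case 0
  then show ?case
    by (auto intro!: continuous_at_imp_continuous_on differentiable_imp_continuous_within)
next
  case (Suc k)
  then show ?case by (metis Ck_on.simps(2))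
qed

lemma Ck_on_const: "Ck_on k (\<lambda>y. a) W"
  by (induction k arbitrary: a) simp_all

lemma Ck_on_add:
  assumes "open W" "Ck_on k f W" "Ck_on k g W"
  shows "Ck_on k (\<lambda>y. f y + g y) W"
  using assms(2,3)
proof (induction k arbitrary: f g)
  case 0
  then show ?case by (simp add: continuous_on_add)
next
  case (Suc k)
  then have d: "f differentiable at y" "g differentiable at y" if "y \<in> W" for y
    using that by auto
  have eq: "frechet_derivative (\<lambda>y. f y + g y) (at y) v =
      frechet_derivative f (at y) v + frechet_derivative g (at y) v" if "y \<in> W" for y v
    by (subst frechet_derivative_at[symmetric])
      (auto intro!: derivative_eq_intros has_frechet_derivative d that)
  have "Ck_on k (\<lambda>y. frechet_derivative (\<lambda>y. f y + g y) (at y) v) W" for v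
    by (subst Ck_on_cong[OF assms(1) eq]) (use Suc in auto)
  then show ?case using d by (auto intro!: differentiable_add)
qed

lemma Ck_on_bilinear:
  assumes "open W" "bounded_bilinear B" "Ck_on k f W" "Ck_on k g W"
  shows "Ck_on k (\<lambda>y. B (f y) (g y)) W"
  using assms(3,4)
proof (induction k arbitrary: f g)
  case 0
  then show ?case by (simp add: bounded_bilinear.continuous_on[OF assms(2)])
next
  case (Suc k)
  then have d: "f differentiable at y" "g differentiable at y" if "y \<in> W" for y
    using that by auto
  have hd: "((\<lambda>y. B (f y) (g y)) has_derivative (\<lambda>v. B (f y) (frechet_derivative g (at y) v)
      + B (frechet_derivative f (at y) v) (g y))) (at y)" if "y \<in> W" for y
    using bounded_bilinear.FDERIV[OF assms(2) d[THEN has_frechet_derivative]] that by blast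
  have eq: "frechet_derivative (\<lambda>y. B (f y) (g y)) (at y) v =
      B (f y) (frechet_derivative g (at y) v) + B (frechet_derivative f (at y) v) (g y)"
    if "y \<in> W" for y v
    using frechet_derivative_at[OF hd[OF that]] by metis
  have "Ck_on k (\<lambda>y. frechet_derivative (\<lambda>y. B (f y) (g y)) (at y) v) W" for v
    by (subst Ck_on_cong[OF assms(1) eq])
      (use Suc.prems Ck_on_SucD[OF Suc.prems(1)] Ck_on_SucD[OF Suc.prems(2)]
        in \<open>auto intro!: Ck_on_add assms Suc.IH\<close>)
  then show ?case using hd by (auto simp: differentiable_def)
qed

lemma Ck_on_minus:
  assumes "open W" "Ck_on k f W"
  shows "Ck_on k (\<lambda>y. - f y) W"
  using Ck_on_bilinear[OF assms(1) bounded_bilinear_scaleR Ck_on_const assms(2), of "-1"] by simp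

lemma Ck_on_inverse:
  fixes f :: "'a::real_normed_vector \<Rightarrow> real"
  assumes "open W" "Ck_on k f W" "\<And>y. y \<in> W \<Longrightarrow> f y \<noteq> 0"
  shows "Ck_on k (\<lambda>y. inverse (f y)) W"
  using assms(2)
proof (induction k)
  case 0
  then show ?case using assms(3) by (auto intro: continuous_on_inverse)
next
  case (Suc k)
  then have d: "f differentiable at y" if "y \<in> W" for y
    using that by auto
  have hd: "((\<lambda>y. inverse (f y)) has_derivative (\<lambda>v. - (frechet_derivative f (at y) v
      * (inverse (f y) * inverse (f y))))) (at y)" if "y \<in> W" for y
    by (rule derivative_eq_intros has_frechet_derivative d that assms(3) refl)+
      (simp add: fun_eq_iff mult_ac)
  have eq: "frechet_derivative (\<lambda>y. inverse (f y)) (at y) v =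
      - (frechet_derivative f (at y) v * (inverse (f y) * inverse (f y)))"
    if "y \<in> W" for y v
    using frechet_derivative_at[OF hd[OF that]] by metis
  have "Ck_on k (\<lambda>y. frechet_derivative (\<lambda>y. inverse (f y)) (at y) v) W" for v
    by (subst Ck_on_cong[OF assms(1) eq])
      (use Suc Ck_on_SucD[OF Suc.prems(1)] in
        \<open>auto intro!: Ck_on_minus Ck_on_bilinear[OF assms(1) bounded_bilinear_mult] assms(1)\<close>)
  then show ?case using hd by (auto simp: differentiable_def)
qed

text \<open>The two mixed second derivatives are limits of one and the same second difference quotient:
  the mean value theorem, applied in each direction in turn, turns the second difference over a
  small parallelogram into a value of the mixed derivative at a nearby point.\<close>

lemma second_difference_mean_value:
  fixes f :: "'a::real_normed_vector \<Rightarrow> real"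
  assumes C: "Ck_on 2 f W" and t: "t > 0"
    and W: "\<And>a b. \<lbrakk>0 \<le> a; a \<le> t; 0 \<le> b; b \<le> t\<rbrakk> \<Longrightarrow> y + a *\<^sub>R u + b *\<^sub>R v \<in> W"
  obtains a b where "0 < a" "a < t" "0 < b" "b < t"
    "f (y + t *\<^sub>R u + t *\<^sub>R v) - f (y + t *\<^sub>R u) - f (y + t *\<^sub>R v) + f y =
      t * t * frechet_derivative (\<lambda>z. frechet_derivative f (at z) u) (at (y + a *\<^sub>R u + b *\<^sub>R v)) v"
proof -
  let ?g = "\<lambda>z. frechet_derivative f (at z) u"
  have df: "(f has_derivative frechet_derivative f (at z)) (at z)"
    and dg: "(?g has_derivative frechet_derivative ?g (at z)) (at z)" if "z \<in> W" for z
    using C that by (auto simp: numeral_2_eq_2 intro!: has_frechet_derivative)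
  have lin: "linear (frechet_derivative f (at z))" "linear (frechet_derivative ?g (at z))" if "z \<in> W" for z
    using df[OF that] dg[OF that] by (auto dest: has_derivative_linear)
  have du: "((\<lambda>s. f (y + s *\<^sub>R u + b *\<^sub>R v)) has_real_derivative ?g (y + s *\<^sub>R u + b *\<^sub>R v)) (at s)"
    if "0 \<le> s" "s \<le> t" "0 \<le> b" "b \<le> t" for s b
  proof -
    have "(f \<circ> (\<lambda>s. y + s *\<^sub>R u + b *\<^sub>R v) has_derivative
        frechet_derivative f (at (y + s *\<^sub>R u + b *\<^sub>R v)) \<circ> (\<lambda>r. r *\<^sub>R u)) (at s)"
      by (rule diff_chain_at) (auto intro!: derivative_eq_intros df W that)
    moreover have "frechet_derivative f (at (y + s *\<^sub>R u + b *\<^sub>R v)) \<circ> (\<lambda>r. r *\<^sub>R u) =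
        (*) (?g (y + s *\<^sub>R u + b *\<^sub>R v))"
      using linear_scale[OF lin(1)[OF W[OF that]]] by (simp add: fun_eq_iff mult.commute)
    ultimately show ?thesis
      unfolding has_field_derivative_def by (simp add: o_def)
  qed
  have dv: "((\<lambda>r. ?g (y + s *\<^sub>R u + r *\<^sub>R v)) has_real_derivative
      frechet_derivative ?g (at (y + s *\<^sub>R u + b *\<^sub>R v)) v) (at b)"
    if "0 \<le> s" "s \<le> t" "0 \<le> b" "b \<le> t" for s b
  proof -
    have "(?g \<circ> (\<lambda>r. y + s *\<^sub>R u + r *\<^sub>R v) has_derivative
        frechet_derivative ?g (at (y + s *\<^sub>R u + b *\<^sub>R v)) \<circ> (\<lambda>r. r *\<^sub>R v)) (at b)"
      by (rule diff_chain_at) (auto intro!: derivative_eq_intros dg W that)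
    moreover have "frechet_derivative ?g (at (y + s *\<^sub>R u + b *\<^sub>R v)) \<circ> (\<lambda>r. r *\<^sub>R v) =
        (*) (frechet_derivative ?g (at (y + s *\<^sub>R u + b *\<^sub>R v)) v)"
      using linear_scale[OF lin(2)[OF W[OF that]]] by (simp add: fun_eq_iff mult.commute)
    ultimately show ?thesis
      unfolding has_field_derivative_def by (simp add: o_def)
  qed
  have "((\<lambda>s. f (y + s *\<^sub>R u + t *\<^sub>R v) - f (y + s *\<^sub>R u + 0 *\<^sub>R v)) has_real_derivative
      ?g (y + s *\<^sub>R u + t *\<^sub>R v) - ?g (y + s *\<^sub>R u + 0 *\<^sub>R v)) (at s)" if "0 \<le> s" "s \<le> t" for s
    by (intro DERIV_diff du) (use that t in auto)
  from MVT2[OF t this] obtain a where a: "0 < a" "a < t" and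
    eqa: "f (y + t *\<^sub>R u + t *\<^sub>R v) - f (y + t *\<^sub>R u + 0 *\<^sub>R v)
      - (f (y + 0 *\<^sub>R u + t *\<^sub>R v) - f (y + 0 *\<^sub>R u + 0 *\<^sub>R v)) =
      (t - 0) * (?g (y + a *\<^sub>R u + t *\<^sub>R v) - ?g (y + a *\<^sub>R u + 0 *\<^sub>R v))"
    by blast
  have "((\<lambda>r. ?g (y + a *\<^sub>R u + r *\<^sub>R v)) has_real_derivative
      frechet_derivative ?g (at (y + a *\<^sub>R u + b *\<^sub>R v)) v) (at b)" if "0 \<le> b" "b \<le> t" for b
    by (rule dv) (use a that in auto)
  from MVT2[OF t this] obtain b where b: "0 < b" "b < t" and
    "?g (y + a *\<^sub>R u + t *\<^sub>R v) - ?g (y + a *\<^sub>R u + 0 *\<^sub>R v) =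
      (t - 0) * frechet_derivative ?g (at (y + a *\<^sub>R u + b *\<^sub>R v)) v"
    by blast
  with eqa a b that show thesis by (auto simp: algebra_simps)
qed

text \<open>By continuity, both mixed derivatives at \<open>y\<close> are within \<open>\<epsilon> / 2\<close> of the value of the second difference
  quotient over a parallelogram that is small enough.\<close>

lemma mixed_second_derivatives_real:
  fixes f :: "'a::real_normed_vector \<Rightarrow> real"
  assumes "open W" "Ck_on 2 f W" "y \<in> W"
  shows "frechet_derivative (\<lambda>z. frechet_derivative f (at z) u) (at y) v =
    frechet_derivative (\<lambda>z. frechet_derivative f (at z) v) (at y) u" (is "?p y = ?q y")
proof -
  let ?p = "\<lambda>y. frechet_derivative (\<lambda>z. frechet_derivative f (at z) u) (at y) v"
  let ?q = "\<lambda>y. frechet_derivative (\<lambda>z. frechet_derivative f (at z) v) (at y) u"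
  have "\<bar>?p y - ?q y\<bar> \<le> 0 + \<epsilon>" if e: "\<epsilon> > 0" for \<epsilon>
  proof -
    have "continuous_on W ?p" "continuous_on W ?q"
      using assms(2) by (auto simp: numeral_2_eq_2)
    then have "isCont ?p y" "isCont ?q y"
      using assms by (auto simp: continuous_on_eq_continuous_at)
    then have lim: "(?p \<longlongrightarrow> ?p y) (nhds y)" "(?q \<longlongrightarrow> ?q y) (nhds y)"
      using tendsto_at_iff_tendsto_nhds[of ?p y] tendsto_at_iff_tendsto_nhds[of ?q y]
      by (auto simp: isCont_def)
    have "\<forall>\<^sub>F z in nhds y. dist (?p z) (?p y) < \<epsilon> / 2"
      "\<forall>\<^sub>F z in nhds y. dist (?q z) (?q y) < \<epsilon> / 2"
      by (rule tendstoD[OF lim(1) half_gt_zero[OF e]], rule tendstoD[OF lim(2) half_gt_zero[OF e]])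
    then obtain d1 d2 where d1: "d1 > 0" "\<And>z. dist z y < d1 \<Longrightarrow> dist (?p z) (?p y) < \<epsilon> / 2"
      and d2: "d2 > 0" "\<And>z. dist z y < d2 \<Longrightarrow> dist (?q z) (?q y) < \<epsilon> / 2"
      unfolding eventually_nhds_metric by blast
    obtain d3 where d3: "d3 > 0" "ball y d3 \<subseteq> W"
      using assms openE by blast
    define d where "d = min d1 (min d2 d3)"
    define K where "K = norm u + norm v + 1"
    define t where "t = d / (2 * K)"
    have pos: "K > 0"
      unfolding K_def
      by (intro add_nonneg_pos add_nonneg_nonneg) auto
    have d: "d > 0" and t: "t > 0" 
      using d1(1) d2(1) d3(1) pos by (simp_all add: d_def t_def)
    have near: "dist (y + a *\<^sub>R u + b *\<^sub>R v) y < d" if "0 \<le> a" "a \<le> t" "0 \<le> b" "b \<le> t" for a b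
    proof -
      have "dist (y + a *\<^sub>R u + b *\<^sub>R v) y = norm (a *\<^sub>R u + b *\<^sub>R v)"
        by (simp add: dist_norm add.assoc)
      also have "\<dots> \<le> norm (a *\<^sub>R u) + norm (b *\<^sub>R v)"
        by (rule norm_triangle_ineq)
      also have "\<dots> \<le> t * norm u + t * norm v"
        using that by (auto intro!: add_mono mult_right_mono)
      also have "\<dots> \<le> t * K"
        using t by (simp add: K_def algebra_simps)
      also have "\<dots> = d / 2"
        using pos by (simp add: t_def)
      finally show ?thesis using d by simp
    qed
    have inW: "y + a *\<^sub>R u + b *\<^sub>R v \<in> W" if "0 \<le> a" "a \<le> t" "0 \<le> b" "b \<le> t" for a b
      using near[OF that] d3 by (auto simp: d_def dist_commute)
    obtain a b where ab: "0 < a" "a < t" "0 < b" "b < t" and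
      1: "f (y + t *\<^sub>R u + t *\<^sub>R v) - f (y + t *\<^sub>R u) - f (y + t *\<^sub>R v) + f y =
      t * t * ?p (y + a *\<^sub>R u + b *\<^sub>R v)"
      using second_difference_mean_value[OF assms(2) t inW] by blast
    have inW': "y + a *\<^sub>R v + b *\<^sub>R u \<in> W" if "0 \<le> a" "a \<le> t" "0 \<le> b" "b \<le> t" for a b
      using inW[of b a] that by (simp add: add_ac)
    obtain a' b' where ab': "0 < a'" "a' < t" "0 < b'" "b' < t" and
      2: "f (y + t *\<^sub>R v + t *\<^sub>R u) - f (y + t *\<^sub>R v) - f (y + t *\<^sub>R u) + f y =
      t * t * ?q (y + a' *\<^sub>R v + b' *\<^sub>R u)"
      using second_difference_mean_value[OF assms(2) t inW'] by blast
    have "t * t * ?p (y + a *\<^sub>R u + b *\<^sub>R v) = t * t * ?q (y + a' *\<^sub>R v + b' *\<^sub>R u)"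
      unfolding 1[symmetric] 2[symmetric] by (simp add: add_ac)
    then have "?p (y + a *\<^sub>R u + b *\<^sub>R v) = ?q (y + b' *\<^sub>R u + a' *\<^sub>R v)"
      using t by (simp add: add_ac)
    moreover have "dist (?p (y + a *\<^sub>R u + b *\<^sub>R v)) (?p y) < \<epsilon> / 2"
      using near[of a b] ab by (intro d1) (auto simp: d_def)
    moreover have "dist (?q (y + b' *\<^sub>R u + a' *\<^sub>R v)) (?q y) < \<epsilon> / 2"
      using near[of b' a'] ab' by (intro d2) (auto simp: d_def)
    ultimately show ?thesis unfolding dist_real_def by linarith
  qed
  then show ?thesis using field_le_epsilon[of "\<bar>?p y - ?q y\<bar>" 0] by simp
qed

lemma mixed_second_derivatives:
  fixes f :: "'a::real_normed_vector \<Rightarrow> 'b::euclidean_space"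
  assumes W: "open W" and C: "Ck_on 2 f W" and y: "y \<in> W"
  shows "frechet_derivative (\<lambda>z. frechet_derivative f (at z) u) (at y) v =
    frechet_derivative (\<lambda>z. frechet_derivative f (at z) v) (at y) u"
proof (rule euclidean_eqI)
  fix b :: 'b
  assume "b \<in> Basis"
  have C': "Ck_on k (\<lambda>z. g z \<bullet> b) W" if "Ck_on k g W" for k g
    by (rule Ck_on_bilinear[OF W bounded_bilinear_inner that Ck_on_const])
  have comp: "frechet_derivative (\<lambda>z. g z \<bullet> b) (at z) w = frechet_derivative g (at z) w \<bullet> b"
    if "g differentiable at z" for g :: "'a \<Rightarrow> 'b" and z w
    by (subst frechet_derivative_at[symmetric])
      (auto intro!: derivative_eq_intros has_frechet_derivative that)
  have d1: "f differentiable at z" if "z \<in> W" for z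
    using C that by (auto simp: numeral_2_eq_2)
  have d2: "(\<lambda>z. frechet_derivative f (at z) w) differentiable at y" for w
    using C y by (auto simp: numeral_2_eq_2)
  have "frechet_derivative (\<lambda>z. frechet_derivative (\<lambda>z. f z \<bullet> b) (at z) w) (at y) w' =
      frechet_derivative (\<lambda>z. frechet_derivative f (at z) w) (at y) w' \<bullet> b" for w w'
    by (subst frechet_derivative_cong_open[OF W y comp[OF d1]]) (auto simp: comp d2)
  then show "frechet_derivative (\<lambda>z. frechet_derivative f (at z) u) (at y) v \<bullet> b =
    frechet_derivative (\<lambda>z. frechet_derivative f (at z) v) (at y) u \<bullet> b"
    using mixed_second_derivatives_real[OF W C'[OF C] y] by metis
qed

section \<open>Calculus in a chart\<close>

text \<open>Functions on the manifold are differentiated through the coordinates of one fixed chart. Only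
  their values on the domain of the chart matter.\<close>

locale smooth_chart =
  fixes c :: "'m chart"
  assumes open_image: "open (snd c ` fst c)"
    and inj_coord: "inj_on (snd c) (fst c)"
begin

definition smooth :: "('m \<Rightarrow> 'b::real_normed_vector) \<Rightarrow> bool" where
  "smooth f \<longleftrightarrow> smooth_on (in_chart c f) (snd c ` fst c)"

definition chart_open :: "'m set \<Rightarrow> bool" where
  "chart_open V \<longleftrightarrow> V \<subseteq> fst c \<and> open (snd c ` V)"

lemma in_chart_coord [simp]: "p \<in> fst c \<Longrightarrow> in_chart c f (snd c p) = f p"
  by (simp add: in_chart_def inj_coord)

lemma chart_open_domain: "chart_open (fst c)"
  by (simp add: chart_open_def open_image)

lemma chart_open_subset: "chart_open V \<Longrightarrow> p \<in> V \<Longrightarrow> p \<in> fst c"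
  by (auto simp: chart_open_def)

lemma differential_cong:
  assumes "chart_open V" "p \<in> V" "\<And>q. q \<in> V \<Longrightarrow> f q = g q"
  shows "differential c f p = differential c g p"
  unfolding differential_def
  by (rule frechet_derivative_cong_open[of "snd c ` V"])
    (use assms in \<open>auto simp: chart_open_def subset_iff\<close>)

lemma smooth_cong:
  assumes "\<And>q. q \<in> fst c \<Longrightarrow> f q = g q"
  shows "smooth f \<longleftrightarrow> smooth g"
  unfolding smooth_def smooth_on_def
  using assms by (intro all_cong1 Ck_on_cong[OF open_image]) auto

lemma smooth_has_derivative:
  assumes "smooth f" "p \<in> fst c"
  shows "(in_chart c f has_derivative differential c f p) (at (snd c p))"
proof -
  have "Ck_on (Suc 0) (in_chart c f) (snd c ` fst c)"
    using assms(1) by (simp only: smooth_def smooth_on_def)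
  then show ?thesis
    unfolding differential_def using assms(2) by (intro has_frechet_derivative) auto
qed

lemma linear_differential: "smooth f \<Longrightarrow> p \<in> fst c \<Longrightarrow> linear (differential c f p)"
  using smooth_has_derivative has_derivative_linear by blast

lemma differential_eqI:
  assumes "(in_chart c f has_derivative f') (at (snd c p))"
  shows "differential c f p v = f' v"
  using frechet_derivative_at[OF assms] by (simp add: differential_def)

lemma chart_open_nonzero:
  fixes f :: "'m \<Rightarrow> real"
  assumes "smooth f" "chart_open V"
  shows "chart_open {q \<in> V. f q \<noteq> 0}"
proof -
  have V: "open (snd c ` V)" "V \<subseteq> fst c"
    using assms(2) by (auto simp: chart_open_def)
  have "Ck_on 0 (in_chart c f) (snd c ` fst c)"
    using assms(1) by (simp only: smooth_def smooth_on_def)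
  then have "continuous_on (snd c ` V) (in_chart c f)"
    using V(2) by (auto intro: continuous_on_subset)
  then have "open (snd c ` V \<inter> in_chart c f -` (- {0}))"
    by (intro continuous_open_preimage V) auto
  moreover have "snd c ` V \<inter> in_chart c f -` (- {0}) = snd c ` {q \<in> V. f q \<noteq> 0}"
    using V(2) by (auto simp: subset_iff)
  ultimately show ?thesis
    using V(2) by (auto simp: chart_open_def)
qed

lemma smooth_const: "smooth (\<lambda>q. a)"
  by (simp add: smooth_def smooth_on_def in_chart_def o_def Ck_on_const)

lemma smooth_add: "smooth f \<Longrightarrow> smooth g \<Longrightarrow> smooth (\<lambda>q. f q + g q)"
  by (simp add: smooth_def smooth_on_def in_chart_def o_def Ck_on_add open_image)

lemma smooth_minus: "smooth f \<Longrightarrow> smooth (\<lambda>q. - f q)"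
  by (simp add: smooth_def smooth_on_def in_chart_def o_def Ck_on_minus open_image)

lemma smooth_diff: "smooth f \<Longrightarrow> smooth g \<Longrightarrow> smooth (\<lambda>q. f q - g q)"
  using smooth_add[of f "\<lambda>q. - g q"] by (simp add: smooth_minus)

lemma smooth_bilinear:
  assumes "bounded_bilinear B" "smooth f" "smooth g"
  shows "smooth (\<lambda>q. B (f q) (g q))"
proof -
  have "in_chart c (\<lambda>q. B (f q) (g q)) = (\<lambda>y. B (in_chart c f y) (in_chart c g y))"
    by (simp add: in_chart_def o_def)
  then show ?thesis
    using assms(2,3) Ck_on_bilinear[OF open_image assms(1)]
    by (simp add: smooth_def smooth_on_def)
qed

lemmas smooth_mult = smooth_bilinear[OF bounded_bilinear_mult]
  and smooth_scaleR = smooth_bilinear[OF bounded_bilinear_scaleR]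

lemma smooth_nth: "smooth f \<Longrightarrow> smooth (\<lambda>q. f q $ i)" for f :: "'m \<Rightarrow> real^'n"
  using smooth_bilinear[OF bounded_bilinear_inner smooth_const, of f "axis i 1"]
  by (simp add: inner_axis')

lemma smooth_sum: "(\<And>i. i \<in> I \<Longrightarrow> smooth (f i)) \<Longrightarrow> smooth (\<lambda>q. \<Sum>i\<in>I. f i q)"
  by (induction I rule: infinite_finite_induct) (simp_all add: smooth_const smooth_add)

lemma smooth_prod:
  "(\<And>i. i \<in> I \<Longrightarrow> smooth (f i)) \<Longrightarrow> smooth (\<lambda>q. \<Prod>i\<in>I. f i q)" for f :: "_ \<Rightarrow> 'm \<Rightarrow> real"
  by (induction I rule: infinite_finite_induct) (simp_all add: smooth_const smooth_mult)

lemma smooth_divide: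
  fixes f g :: "'m \<Rightarrow> real"
  assumes "smooth f" "smooth g" "\<And>q. q \<in> fst c \<Longrightarrow> g q \<noteq> 0"
  shows "smooth (\<lambda>q. f q / g q)"
proof -
  have "Ck_on k (\<lambda>y. inverse (in_chart c g y)) (snd c ` fst c)" for k
    using assms by (intro Ck_on_inverse open_image) (auto simp: smooth_def smooth_on_def)
  then have "smooth (\<lambda>q. inverse (g q))"
    by (simp add: smooth_def smooth_on_def in_chart_def o_def)
  then show ?thesis
    unfolding divide_inverse by (intro smooth_mult assms)
qed

lemma smooth_det:
  fixes M :: "'m \<Rightarrow> real^'n^'n"
  assumes "\<And>i j. smooth (\<lambda>q. M q $ i $ j)"
  shows "smooth (\<lambda>q. det (M q))"
  unfolding det_def by (intro smooth_sum smooth_mult smooth_const smooth_prod assms)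

lemma in_chart_differential:
  assumes "y \<in> snd c ` fst c"
  shows "in_chart c (\<lambda>q. differential c f q v) y = frechet_derivative (in_chart c f) (at y) v"
  using assms by (auto simp: differential_def)

lemma smooth_differential: "smooth f \<Longrightarrow> smooth (\<lambda>q. differential c f q v)"
proof -
  assume f: "smooth f"
  have "Ck_on k (in_chart c (\<lambda>q. differential c f q v)) (snd c ` fst c)" for k
  proof -
    have "Ck_on (Suc k) (in_chart c f) (snd c ` fst c)"
      using f by (simp only: smooth_def smooth_on_def)
    then show ?thesis
      by (simp add: Ck_on_cong[OF open_image in_chart_differential])
  qed
  then show ?thesis by (simp add: smooth_def smooth_on_def)
qed

lemma smooth_partial: "smooth f \<Longrightarrow> smooth (\<lambda>q. partial c i f q)"
  by (simp add: partial_def smooth_differential)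

lemma differential_const: "differential c (\<lambda>q. a) p v = 0"
  by (simp add: differential_def in_chart_def o_def)

lemma differential_add:
  assumes "smooth f" "smooth g" "p \<in> fst c"
  shows "differential c (\<lambda>q. f q + g q) p v = differential c f p v + differential c g p v"
  using has_derivative_add[OF smooth_has_derivative[OF assms(1,3)] smooth_has_derivative[OF assms(2,3)]]
  by (intro differential_eqI) (simp add: in_chart_def o_def)

lemma differential_bilinear:
  assumes "bounded_bilinear B" "smooth f" "smooth g" "p \<in> fst c"
  shows "differential c (\<lambda>q. B (f q) (g q)) p v =
    B (differential c f p v) (g p) + B (f p) (differential c g p v)"
proof -
  have "((\<lambda>y. B (in_chart c f y) (in_chart c g y)) has_derivative
      (\<lambda>v. B (in_chart c f (snd c p)) (differential c g p v)
        + B (differential c f p v) (in_chart c g (snd c p)))) (at (snd c p))"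
    by (rule bounded_bilinear.FDERIV[OF assms(1) smooth_has_derivative[OF assms(2,4)]
          smooth_has_derivative[OF assms(3,4)]])
  moreover have "in_chart c (\<lambda>q. B (f q) (g q)) = (\<lambda>y. B (in_chart c f y) (in_chart c g y))"
    by (simp add: in_chart_def o_def)
  ultimately show ?thesis
    using assms(4) by (subst differential_eqI) (auto simp: add.commute)
qed

lemma differential_symmetric:
  fixes f :: "'m \<Rightarrow> 'b::euclidean_space"
  assumes "smooth f" "p \<in> fst c"
  shows "differential c (\<lambda>q. differential c f q u) p v =
    differential c (\<lambda>q. differential c f q v) p u"
proof -
  have C: "Ck_on 2 (in_chart c f) (snd c ` fst c)"
    using assms(1) by (simp only: smooth_def smooth_on_def)
  have *: "differential c (\<lambda>q. differential c f q u) p v =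
      frechet_derivative (\<lambda>y. frechet_derivative (in_chart c f) (at y) u) (at (snd c p)) v" for u v
    unfolding differential_def[of c "\<lambda>q. differential c f q u" for u]
    by (subst frechet_derivative_cong_open[OF open_image _ in_chart_differential]) (use assms in auto)
  show ?thesis
    unfolding * by (rule mixed_second_derivatives[OF open_image C]) (use assms in auto)
qed

lemma differential_partial_sum:
  assumes "smooth f" "p \<in> fst c"
  shows "differential c f p v = (\<Sum>m\<in>UNIV. v $ m *\<^sub>R partial c m f p)"
proof -
  have "v = (\<Sum>m\<in>UNIV. v $ m *\<^sub>R axis m 1)"
    using basis_expansion[of v] by (simp add: scalar_mult_eq_scaleR)
  then have "differential c f p v = differential c f p (\<Sum>m\<in>UNIV. v $ m *\<^sub>R axis m 1)"
    by (rule arg_cong)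
  also have "\<dots> = (\<Sum>m\<in>UNIV. v $ m *\<^sub>R differential c f p (axis m 1))"
    by (simp only: linear_sum[OF linear_differential[OF assms]] linear_scale[OF linear_differential[OF assms]])
  finally show ?thesis by (simp only: partial_def)
qed

end

section \<open>Minkowski space and contraction with a null frame\<close>

lemma linear_mink_left: "linear (\<lambda>u. mink u v)"
  by (rule linearI) (simp_all add: mink_def algebra_simps)

lemma linear_mink_right: "linear (\<lambda>v. mink u v)"
  by (rule linearI) (simp_all add: mink_def algebra_simps)

lemma bounded_bilinear_mink: "bounded_bilinear mink"
  by (simp add: bilinear_conv_bounded_bilinear[symmetric] bilinear_def linear_mink_left linear_mink_right)

lemma mink_commute: "mink u v = mink v u"
  by (simp add: mink_def mult.commute)

lemmas mink_simps =
  linear_add[OF linear_mink_left] linear_add[OF linear_mink_right]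
  linear_diff[OF linear_mink_left] linear_diff[OF linear_mink_right]
  linear_neg[OF linear_mink_left] linear_neg[OF linear_mink_right]
  linear_scale[OF linear_mink_left] linear_scale[OF linear_mink_right]
  linear_0[OF linear_mink_left] linear_0[OF linear_mink_right]

definition gram :: "4 \<Rightarrow> 4 \<Rightarrow> real" where
  "gram i j = (if {i, j} = {1, 2} then - 1 else if i = j \<and> i \<in> {3, 4} then 1 else 0)"

lemma gram_simps [simp]:
  "gram 1 1 = 0" "gram 1 2 = -1" "gram 1 3 = 0" "gram 1 4 = 0"
  "gram 2 1 = -1" "gram 2 2 = 0" "gram 2 3 = 0" "gram 2 4 = 0"
  "gram 3 1 = 0" "gram 3 2 = 0" "gram 3 3 = 1" "gram 3 4 = 0"
  "gram 4 1 = 0" "gram 4 2 = 0" "gram 4 3 = 0" "gram 4 4 = 1"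
  by (auto simp: gram_def doubleton_eq_iff)

text \<open>The contraction of a bilinear expression with the inverse of the Gram matrix of a
  pseudo-orthonormal frame; that matrix is its own inverse.\<close>

definition null_trace :: "(4 \<Rightarrow> 4 \<Rightarrow> 'b::real_vector) \<Rightarrow> 'b" where
  "null_trace b = - b 1 2 - b 2 1 + b 3 3 + b 4 4"

lemma null_trace_linear: "linear h \<Longrightarrow> h (null_trace b) = null_trace (\<lambda>i j. h (b i j))"
  by (simp add: null_trace_def linear_add linear_diff linear_neg)

lemma null_trace_sum: "null_trace (\<lambda>i j. \<Sum>m\<in>M. b m i j) = (\<Sum>m\<in>M. null_trace (b m))"
  by (simp add: null_trace_def sum.distrib sum_subtractf sum_negf)

lemma null_trace_add: "null_trace (\<lambda>i j. b i j + b' i j) = null_trace b + null_trace b'"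
  by (simp add: null_trace_def)

lemma null_trace_gram:
  fixes b :: "4 \<Rightarrow> real"
  shows "null_trace (\<lambda>i j. b i * gram j m) = b m" "null_trace (\<lambda>i j. b i * gram m j) = b m"
  using exhaust_4[of m] by (auto simp: null_trace_def)

lemma forall_5: "(\<forall>i::5. P i) \<longleftrightarrow> P 1 \<and> P 2 \<and> P 3 \<and> P 4 \<and> P 5"
proof -
  have "x = 1 \<or> x = 2 \<or> x = 3 \<or> x = 4 \<or> x = 5" for x :: 5
  proof (induct x)
    case (of_int z)
    then have "z = 0 \<or> z = 1 \<or> z = 2 \<or> z = 3 \<or> z = 4" by auto
    then show ?case by auto
  qed
  then show ?thesis by metis
qed

lemma vector_5:
  "(vector [a1, a2, a3, a4, a5] :: 'a::zero^5) $ 1 = a1"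
  "(vector [a1, a2, a3, a4, a5] :: 'a::zero^5) $ 2 = a2"
  "(vector [a1, a2, a3, a4, a5] :: 'a::zero^5) $ 3 = a3"
  "(vector [a1, a2, a3, a4, a5] :: 'a::zero^5) $ 4 = a4"
  "(vector [a1, a2, a3, a4, a5] :: 'a::zero^5) $ 5 = a5"
  unfolding vector_def by simp_all

section \<open>The structure of a hypersurface in a pseudo-orthonormal frame\<close>

locale null_framed_chart = smooth_chart c for c :: "'m chart" +
  fixes x N :: "'m \<Rightarrow> real^5" and e :: "4 \<Rightarrow> 'm \<Rightarrow> real^5"
  assumes smooth_x: "smooth x" and smooth_N: "smooth N" and smooth_e: "smooth (e i)"
    and immersion: "p \<in> fst c \<Longrightarrow> inj (differential c x p)"
    and frame_tangent: "p \<in> fst c \<Longrightarrow> e i p \<in> tangent_space c x p"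
    and frame_gram: "p \<in> fst c \<Longrightarrow> mink (e i p) (e j p) = gram i j"
    and normal_unit: "p \<in> fst c \<Longrightarrow> mink (N p) (N p) = 1"
    and normal_tangent: "p \<in> fst c \<Longrightarrow> mink (N p) (differential c x p v) = 0"
begin

text \<open>The frame in chart coordinates, the flat derivative along a frame vector, and the connection
  coefficients: \<open>w i j m\<close> is \<open>\<langle>\<nabla>\<^sub>e\<^sub>i e\<^sub>j, e\<^sub>m\<rangle>\<close>, because the normal part of the flat derivative is
  orthogonal to \<open>e\<^sub>m\<close>.\<close>

definition E :: "4 \<Rightarrow> 'm \<Rightarrow> real^4" where
  "E i p = components c x p (e i p)"

definition D :: "4 \<Rightarrow> ('m \<Rightarrow> 'b::real_normed_vector) \<Rightarrow> 'm \<Rightarrow> 'b" where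
  "D i f p = differential c f p (E i p)"

definition w :: "4 \<Rightarrow> 4 \<Rightarrow> 4 \<Rightarrow> 'm \<Rightarrow> real" where
  "w i j m p = mink (D i (e j) p) (e m p)"

lemmas linear_dx = linear_differential[OF smooth_x]

lemmas dx_simps =
  linear_add[OF linear_dx] linear_diff[OF linear_dx] linear_neg[OF linear_dx]
  linear_scale[OF linear_dx]

lemma components_differential: "p \<in> fst c \<Longrightarrow> components c x p (differential c x p v) = v"
  unfolding components_def using injD[OF immersion] by blast

lemma differential_x_E: "p \<in> fst c \<Longrightarrow> differential c x p (E i p) = e i p"
  using frame_tangent[of p i] by (auto simp: E_def tangent_space_def components_differential)

lemma normal_frame: "p \<in> fst c \<Longrightarrow> mink (N p) (e i p) = 0"
  using normal_tangent[of p "E i p"] by (simp add: differential_x_E)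

lemma frame_normal: "p \<in> fst c \<Longrightarrow> mink (e i p) (N p) = 0"
  using normal_frame mink_commute by metis

text \<open>The products with the frame determine a tangent vector: the products with \<open>e 1, \<dots>, e 4\<close>
  define a linear map of \<open>real^4\<close> to itself, which the Gram matrix shows to be onto, and which is
  therefore injective.\<close>

lemma linear_frame_products:
  assumes "p \<in> fst c"
  shows "linear (\<lambda>v. \<chi> i. mink (e i p) (differential c x p v))"
  by (rule linearI) (simp_all add: vec_eq_iff linear_add[OF linear_dx[OF assms]]
      linear_scale[OF linear_dx[OF assms]] mink_simps)

lemma frame_products_inj:
  assumes p: "p \<in> fst c"
  shows "inj (\<lambda>v. \<chi> i. mink (e i p) (differential c x p v))" (is "inj ?\<phi>")
proof (rule linear_surjective_imp_injective[OF linear_frame_products[OF p] _ refl])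
  have "t = ?\<phi> (null_trace (\<lambda>i j. t $ j *\<^sub>R E i p))" for t
    by (simp add: vec_eq_iff null_trace_linear[OF linear_dx[OF p]] null_trace_linear[OF linear_mink_right]
        differential_x_E p dx_simps mink_simps frame_gram
        null_trace_def forall_4)
  then show "surj ?\<phi>" by (rule surjI[OF sym])
qed

lemma tangent_expansion:
  assumes p: "p \<in> fst c"
  shows "v = null_trace (\<lambda>i j. mink (differential c x p v) (e j p) *\<^sub>R E i p)"
  by (rule injD[OF frame_products_inj[OF p]])
    (simp add: vec_eq_iff null_trace_linear[OF linear_dx[OF p]] null_trace_linear[OF linear_mink_right]
        differential_x_E p dx_simps mink_simps frame_gram
        null_trace_def forall_4 mink_commute)

text \<open>As for tangent vectors: the products with the four frame vectors and the normal define a linear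
  surjection, hence an injection, of \<open>real^5\<close>.\<close>

lemma ambient_expansion:
  assumes p: "p \<in> fst c"
  shows "Z = null_trace (\<lambda>i j. mink Z (e j p) *\<^sub>R e i p) + mink Z (N p) *\<^sub>R N p"
proof -
  define \<phi> :: "real^5 \<Rightarrow> real^5" where
    "\<phi> Z = vector [mink Z (e 1 p), mink Z (e 2 p), mink Z (e 3 p), mink Z (e 4 p), mink Z (N p)]" for Z
  have "linear \<phi>"
    by (rule linearI) (simp_all add: \<phi>_def vec_eq_iff forall_5 vector_5 mink_simps)
  moreover have "\<phi> (- t$2 *\<^sub>R e 1 p - t$1 *\<^sub>R e 2 p + t$3 *\<^sub>R e 3 p + t$4 *\<^sub>R e 4 p + t$5 *\<^sub>R N p) = t" for t
    by (simp add: \<phi>_def vec_eq_iff forall_5 vector_5 mink_simps frame_gram p normal_unit normal_frame frame_normal)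
  then have "surj \<phi>" by (rule surjI)
  ultimately have "inj \<phi>" by (rule linear_surjective_imp_injective) (rule refl)
  then show ?thesis
    by (rule injD) (simp add: \<phi>_def vec_eq_iff forall_5 vector_5 mink_simps frame_gram p normal_unit
      normal_frame frame_normal null_trace_def)
qed

lemma mink_expansion:
  assumes p: "p \<in> fst c"
  shows "mink Y Z = null_trace (\<lambda>i j. mink Y (e i p) * mink Z (e j p)) + mink Y (N p) * mink Z (N p)"
proof -
  have "mink Y Z = mink Y (null_trace (\<lambda>i j. mink Z (e j p) *\<^sub>R e i p) + mink Z (N p) *\<^sub>R N p)"
    using ambient_expansion[OF p, of Z] by (rule arg_cong)
  then show ?thesis
    by (simp add: mink_simps null_trace_linear[OF linear_mink_right] mult.commute)
qed

lemma smooth_mink: "smooth f \<Longrightarrow> smooth g \<Longrightarrow> smooth (\<lambda>q. mink (f q) (g q))"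
  by (rule smooth_bilinear[OF bounded_bilinear_mink])

text \<open>The components of the frame in the chart solve a linear system with smooth coefficients, so
  Cramer's rule shows that they are smooth.\<close>

lemma smooth_E: "smooth (\<lambda>q. E i q $ m)"
proof -
  define T where "T q = (\<chi> b j. mink (e b q) (partial c j x q))" for q
  have T_mult: "T q *v v = (\<chi> b. mink (e b q) (differential c x q v))" if q: "q \<in> fst c" for q v
    by (simp add: T_def matrix_vector_mult_def vec_eq_iff differential_partial_sum[OF smooth_x q]
      linear_sum[OF linear_mink_right] mink_simps mult.commute)
  have det: "det (T q) \<noteq> 0" if q: "q \<in> fst c" for q
  proof -
    have "inj ((*v) (T q))"
      using frame_products_inj[OF q] by (simp add: T_mult[OF q, abs_def])
    then show ?thesis
      by (metis invertible_det_nz invertible_left_inverse matrix_left_invertible_injective)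
  qed
  have "E i q $ m = det (\<chi> a j. if j = m then gram a i else T q $ a $ j) / det (T q)"
    if q: "q \<in> fst c" for q
  proof -
    have "T q *v E i q = (\<chi> a. gram a i)"
      by (simp add: T_mult q differential_x_E frame_gram)
    then have "E i q = (\<chi> k. det (\<chi> a j. if j = k then (\<chi> a. gram a i) $ a else T q $ a $ j) / det (T q))"
      by (simp only: cramer[OF det[OF q]])
    then show ?thesis by (simp add: vec_eq_iff cong: if_cong)
  qed
  moreover have T_smooth: "smooth (\<lambda>q. T q $ a $ j)" for a j
    by (simp add: T_def smooth_mink smooth_e smooth_partial smooth_x)
  then have "smooth (\<lambda>q. (if j = m then gram a i else T q $ a $ j))" for a j
    by (cases "j = m") (simp_all add: smooth_const)
  then have "smooth (\<lambda>q. det (\<chi> a j. if j = m then gram a i else T q $ a $ j) / det (T q))"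
    by (intro smooth_divide smooth_det det T_smooth) simp_all
  ultimately show ?thesis
    using smooth_cong by (metis (no_types, lifting))
qed

lemma D_partial_sum:
  "smooth f \<Longrightarrow> p \<in> fst c \<Longrightarrow> D i f p = (\<Sum>m\<in>UNIV. E i p $ m *\<^sub>R partial c m f p)"
  by (simp add: D_def differential_partial_sum)

lemma smooth_D: "smooth f \<Longrightarrow> smooth (D i f)"
  by (subst smooth_cong[OF D_partial_sum])
    (auto intro!: smooth_sum smooth_scaleR smooth_E smooth_partial)

lemma smooth_w: "smooth (w i j m)"
  using smooth_mink[OF smooth_D[OF smooth_e] smooth_e] by (simp add: w_def[abs_def])

lemma D_cong: "chart_open V \<Longrightarrow> p \<in> V \<Longrightarrow> (\<And>q. q \<in> V \<Longrightarrow> f q = g q) \<Longrightarrow> D i f p = D i g p"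
  unfolding D_def using differential_cong[of V p f g] by simp

lemmas D_cong_domain = D_cong[OF chart_open_domain]

lemma D_const: "D i (\<lambda>q. a) p = 0"
  by (simp add: D_def differential_const)

lemma D_add:
  "\<lbrakk>smooth f; smooth g; p \<in> fst c\<rbrakk> \<Longrightarrow> D i (\<lambda>q. f q + g q) p = D i f p + D i g p"
  by (simp add: D_def differential_add)

lemma D_bilinear:
  "\<lbrakk>bounded_bilinear B; smooth f; smooth g; p \<in> fst c\<rbrakk> \<Longrightarrow>
    D i (\<lambda>q. B (f q) (g q)) p = B (D i f p) (g p) + B (f p) (D i g p)"
  by (simp add: D_def differential_bilinear)

lemmas D_mult = D_bilinear[OF bounded_bilinear_mult]
  and D_scaleR = D_bilinear[OF bounded_bilinear_scaleR]
  and D_mink = D_bilinear[OF bounded_bilinear_mink]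

lemma D_cmult: "smooth f \<Longrightarrow> p \<in> fst c \<Longrightarrow> D i (\<lambda>q. a * f q) p = a * D i f p" for f :: "'m \<Rightarrow> real"
  by (simp add: D_mult smooth_const D_const)

lemma D_minus: "smooth f \<Longrightarrow> p \<in> fst c \<Longrightarrow> D i (\<lambda>q. - f q) p = - D i f p"
  using D_scaleR[of "\<lambda>q. -1" f p i] by (simp add: smooth_const D_const)

lemma D_diff:
  "\<lbrakk>smooth f; smooth g; p \<in> fst c\<rbrakk> \<Longrightarrow> D i (\<lambda>q. f q - g q) p = D i f p - D i g p"
  using D_add[of f "\<lambda>q. - g q" p i] by (simp add: smooth_minus D_minus)

lemma D_sum:
  "\<lbrakk>\<And>m. m \<in> M \<Longrightarrow> smooth (f m); p \<in> fst c\<rbrakk> \<Longrightarrow>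
    D i (\<lambda>q. \<Sum>m\<in>M. f m q) p = (\<Sum>m\<in>M. D i (f m) p)"
  by (induction M rule: infinite_finite_induct) (simp_all add: D_const D_add smooth_sum)

lemma smooth_null_trace: "(\<And>i j. smooth (f i j)) \<Longrightarrow> smooth (\<lambda>q. null_trace (\<lambda>i j. f i j q))"
  unfolding null_trace_def by (intro smooth_add smooth_diff smooth_minus)

lemma D_null_trace:
  "\<lbrakk>\<And>i j. smooth (f i j); p \<in> fst c\<rbrakk> \<Longrightarrow>
    D a (\<lambda>q. null_trace (\<lambda>i j. f i j q)) p = null_trace (\<lambda>i j. D a (f i j) p)"
  unfolding null_trace_def by (simp add: D_add D_diff D_minus smooth_add smooth_diff smooth_minus)

lemma D_nth: "smooth f \<Longrightarrow> p \<in> fst c \<Longrightarrow> D i (\<lambda>q. f q $ m) p = D i f p $ m" for f :: "'m \<Rightarrow> real^'n"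
  using D_bilinear[OF bounded_bilinear_inner smooth_const, of f p i "axis m 1"]
  by (simp add: inner_axis' D_const)

lemma D_locally_const:
  assumes "chart_open V" "p \<in> V" "\<And>q. q \<in> V \<Longrightarrow> f q = a"
  shows "D i f p = 0"
  using D_cong[of V p f "\<lambda>q. a" i] assms by (simp add: D_const)

lemma D_x: "p \<in> fst c \<Longrightarrow> D i x p = e i p"
  by (simp add: D_def differential_x_E)

lemma w_antisym:
  assumes "p \<in> fst c"
  shows "w i j m p = - w i m j p"
proof -
  have "D i (\<lambda>q. mink (e j q) (e m q)) p = D i (\<lambda>q. gram j m) p"
    by (rule D_cong_domain[OF assms]) (rule frame_gram)
  then show ?thesis
    by (simp add: w_def D_mink smooth_e assms D_const mink_commute)
qed

text \<open>The Lie bracket of \<open>E i\<close> and \<open>E j\<close>. Applied to the immersion itself, the commutator of the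
  two derivations gives \<open>D i (e j) - D j (e i)\<close>, so the connection coefficients determine the
  bracket: the connection has no torsion.\<close>

definition bracket :: "4 \<Rightarrow> 4 \<Rightarrow> 'm \<Rightarrow> real^4" where
  "bracket i j p = (\<chi> m. D i (\<lambda>q. E j q $ m) p - D j (\<lambda>q. E i q $ m) p)"

lemma commutator_bracket:
  fixes f :: "'m \<Rightarrow> 'b::euclidean_space"
  assumes f: "smooth f" and p: "p \<in> fst c"
  shows "D i (D j f) p - D j (D i f) p = differential c f p (bracket i j p)"
proof -
  \<comment> \<open>\<open>D i (D j f)\<close> is a derivative of the components of \<open>E j\<close> plus the second derivative of \<open>f\<close> in the
    directions \<open>E i p\<close> and \<open>E j p\<close>, held constant; the latter is symmetric and cancels.\<close>
  have sp: "smooth (\<lambda>q. E j q $ m *\<^sub>R partial c m f q)" for j m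
    by (intro smooth_scaleR smooth_E smooth_partial f)
  have "D i (D j f) p = (\<Sum>m\<in>UNIV. D i (\<lambda>q. E j q $ m) p *\<^sub>R partial c m f p) +
      differential c (\<lambda>q. differential c f q (E i p)) p (E j p)" for i j
  proof -
    have "D i (D j f) p = D i (\<lambda>q. \<Sum>m\<in>UNIV. E j q $ m *\<^sub>R partial c m f q) p"
      by (rule D_cong_domain[OF p]) (rule D_partial_sum[OF f])
    also have "\<dots> = (\<Sum>m\<in>UNIV. D i (\<lambda>q. E j q $ m) p *\<^sub>R partial c m f p) +
        (\<Sum>m\<in>UNIV. E j p $ m *\<^sub>R D i (partial c m f) p)"
      by (simp add: D_sum sp p D_scaleR smooth_E smooth_partial f sum.distrib)
    also have "(\<Sum>m\<in>UNIV. E j p $ m *\<^sub>R D i (partial c m f) p) =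
        (\<Sum>m\<in>UNIV. E j p $ m *\<^sub>R partial c m (\<lambda>q. differential c f q (E i p)) p)"
      unfolding D_def partial_def
      by (rule sum.cong[OF refl]) (simp add: differential_symmetric[OF f p, of _ "E i p"])
    also have "\<dots> = differential c (\<lambda>q. differential c f q (E i p)) p (E j p)"
      by (rule differential_partial_sum[symmetric, OF smooth_differential[OF f] p])
    finally show ?thesis .
  qed
  then have "D i (D j f) p - D j (D i f) p =
      (\<Sum>m\<in>UNIV. (D i (\<lambda>q. E j q $ m) p - D j (\<lambda>q. E i q $ m) p) *\<^sub>R partial c m f p)"
    using differential_symmetric[OF f p, of "E i p" "E j p"]
    by (simp add: sum_subtractf scaleR_left_diff_distrib)
  then show ?thesis
    by (simp add: differential_partial_sum[OF f p] bracket_def)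
qed

lemma differential_x_bracket:
  assumes p: "p \<in> fst c"
  shows "differential c x p (bracket i j p) = D i (e j) p - D j (e i) p"
proof -
  have "D i (D j x) p = D i (e j) p" for i j
    by (rule D_cong_domain[OF p D_x])
  then show ?thesis
    using commutator_bracket[OF smooth_x p, of i j] by simp
qed

lemma bracket_expansion:
  assumes p: "p \<in> fst c"
  shows "bracket i j p = null_trace (\<lambda>a b. (w i j b p - w j i b p) *\<^sub>R E a p)"
  using tangent_expansion[OF p, of "bracket i j p"]
  by (simp add: differential_x_bracket[OF p] w_def mink_simps)

text \<open>The source of all integrability conditions: the Gauss and Codazzi equations are this identity for
  \<open>f\<close> a frame vector and for \<open>f\<close> the normal.\<close>

lemma commutator:
  fixes f :: "'m \<Rightarrow> 'b::euclidean_space"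
  assumes f: "smooth f" and p: "p \<in> fst c"
  shows "D i (D j f) p - D j (D i f) p = null_trace (\<lambda>a b. (w i j b p - w j i b p) *\<^sub>R D a f p)"
  unfolding commutator_bracket[OF assms] bracket_expansion[OF p]
  by (simp add: null_trace_linear[OF linear_differential[OF assms]]
      linear_scale[OF linear_differential[OF assms]] D_def)

end

section \<open>The Laplace operator in a null frame\<close>

lemma matrix_inv_unique:
  fixes M P :: "real^'n^'n"
  assumes "P ** M = mat 1"
  shows "matrix_inv M = P"
proof -
  have "M ** P = mat 1"
    using assms by (simp add: matrix_left_right_inverse)
  then have "M ** matrix_inv M = mat 1 \<and> matrix_inv M ** M = mat 1"
    unfolding matrix_inv_def using assms by (metis (mono_tags, lifting) someI_ex)
  then show ?thesis
    by (metis assms matrix_mul_assoc matrix_mul_lid matrix_mul_rid)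
qed

context null_framed_chart
begin

text \<open>The frame and its metrically dual coframe are inverse to each other.\<close>

lemma frame_completeness:
  assumes p: "p \<in> fst c"
  shows "null_trace (\<lambda>a b. E a p $ i * mink (partial c j x p) (e b p)) = (if i = j then 1 else 0)"
proof -
  have "null_trace (\<lambda>a b. E a p $ i * mink (partial c j x p) (e b p)) =
      null_trace (\<lambda>a b. mink (differential c x p (axis j 1)) (e b p) *\<^sub>R E a p) $ i"
    by (simp add: null_trace_def partial_def mult.commute)
  also have "\<dots> = axis j 1 $ i"
    using tangent_expansion[OF p, of "axis j 1"] by simp
  finally show ?thesis by (simp add: axis_def eq_commute)
qed

text \<open>A frame with a constant Gram matrix makes the inverse metric explicit, so that it never has to be
  differentiated as an inverse matrix.\<close>

lemma metric_inverse:
  assumes p: "p \<in> fst c"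
  shows "matrix_inv (metric c x p) = (\<chi> i l. null_trace (\<lambda>a b. E a p $ i * E b p $ l))"
proof (rule matrix_inv_unique)
  have "(\<Sum>l\<in>UNIV. null_trace (\<lambda>a b. E a p $ i * E b p $ l) * mink (partial c l x p) (partial c j x p))
      = (if i = j then 1 else 0)" for i j
  proof -
    have "(\<Sum>l\<in>UNIV. null_trace (\<lambda>a b. E a p $ i * E b p $ l) * mink (partial c l x p) (partial c j x p))
        = null_trace (\<lambda>a b. E a p $ i * mink (\<Sum>l\<in>UNIV. E b p $ l *\<^sub>R partial c l x p) (partial c j x p))"
      by (simp add: null_trace_def linear_sum[OF linear_mink_left] mink_simps sum_distrib_left
          sum_distrib_right algebra_simps sum.distrib sum_subtractf sum_negf)
    also have "\<dots> = null_trace (\<lambda>a b. E a p $ i * mink (partial c j x p) (e b p))"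
      by (simp add: differential_partial_sum[OF smooth_x p, symmetric] differential_x_E p mink_commute)
    finally show ?thesis by (simp only: frame_completeness[OF p])
  qed
  then show "(\<chi> i l. null_trace (\<lambda>a b. E a p $ i * E b p $ l)) ** metric c x p = mat 1"
    by (simp add: vec_eq_iff matrix_matrix_mult_def mat_def metric_def)
qed

text \<open>This carries the two coordinate traces, of the divergence and of the mean curvature, over to the
  frame.\<close>

lemma trace_null_frame:
  assumes p: "p \<in> fst c"
  shows "(\<Sum>i\<in>UNIV. M $ i $ i) = null_trace (\<lambda>a b. mink (differential c x p (M *v E a p)) (e b p))"
proof -
  have "null_trace (\<lambda>a b. mink (differential c x p (M *v E a p)) (e b p)) =
      null_trace (\<lambda>a b. \<Sum>i\<in>UNIV. \<Sum>j\<in>UNIV. M $ i $ j * (E a p $ j * mink (partial c i x p) (e b p)))"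
    by (simp add: differential_partial_sum[OF smooth_x p] linear_sum[OF linear_mink_left] mink_simps
        matrix_vector_mult_def sum_distrib_right mult.assoc)
  also have "\<dots> = (\<Sum>i\<in>UNIV. \<Sum>j\<in>UNIV. M $ i $ j * null_trace (\<lambda>a b. E a p $ j * mink (partial c i x p) (e b p)))"
    unfolding null_trace_sum by (simp add: null_trace_def algebra_simps)
  also have "\<dots> = (\<Sum>i\<in>UNIV. M $ i $ i)"
    by (simp add: frame_completeness[OF p] if_distrib cong: if_cong)
  finally show ?thesis by simp
qed

lemma gradient_null_frame:
  assumes f: "smooth f" and p: "p \<in> fst c"
  shows "gradient c x f p = null_trace (\<lambda>a b. D b f p *\<^sub>R E a p)"
proof -
  have "(\<Sum>j\<in>UNIV. null_trace (\<lambda>a b. E a p $ i * E b p $ j) * partial c j f p) =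
      null_trace (\<lambda>a b. E a p $ i * D b f p)" for i
    by (simp add: null_trace_def D_partial_sum[OF f p] sum_distrib_left sum_distrib_right
        algebra_simps sum.distrib sum_subtractf sum_negf)
  then show ?thesis
    by (simp add: gradient_def metric_inverse[OF p] matrix_vector_mult_def vec_eq_iff null_trace_def
        mult.commute)
qed

lemma partial_bilinear:
  "\<lbrakk>bounded_bilinear B; smooth f; smooth g; p \<in> fst c\<rbrakk> \<Longrightarrow>
    partial c i (\<lambda>q. B (f q) (g q)) p = B (partial c i f p) (g p) + B (f p) (partial c i g p)"
  by (simp add: partial_def differential_bilinear)

text \<open>By the symmetry of second derivatives, the terms of the metric derivatives in a Christoffel symbol
  cancel except for twice the product of a second derivative of the immersion with a coordinate
  vector.\<close>

lemma christoffel_null_frame: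
  assumes p: "p \<in> fst c"
  shows "christoffel c x k i j p =
    null_trace (\<lambda>a b. E a p $ k * mink (partial c i (partial c j x) p) (e b p))"
proof -
  have sym: "partial c i (partial c j x) p = partial c j (partial c i x) p" for i j
    unfolding partial_def by (rule differential_symmetric[OF smooth_x p])
  have dmetric: "partial c i (\<lambda>q. metric c x q $ j $ l) p =
      mink (partial c i (partial c j x) p) (partial c l x p)
      + mink (partial c j x p) (partial c i (partial c l x) p)" for i j l
    by (simp add: metric_def partial_bilinear[OF bounded_bilinear_mink] smooth_partial smooth_x p)
  have "(partial c i (\<lambda>q. metric c x q $ j $ l) p + partial c j (\<lambda>q. metric c x q $ i $ l) p
      - partial c l (\<lambda>q. metric c x q $ i $ j) p) =
      2 * mink (partial c i (partial c j x) p) (partial c l x p)" for l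
    unfolding dmetric
    by (simp add: sym[of l i] sym[of l j] sym[of j i] mink_commute)
  then have "christoffel c x k i j p =
      (\<Sum>l\<in>UNIV. null_trace (\<lambda>a b. E a p $ k * E b p $ l) *
        mink (partial c i (partial c j x) p) (partial c l x p))"
    by (simp add: christoffel_def metric_inverse[OF p] sum_distrib_left[symmetric] mult.left_commute)
  also have "\<dots> = null_trace (\<lambda>a b. E a p $ k *
      mink (partial c i (partial c j x) p) (\<Sum>l\<in>UNIV. E b p $ l *\<^sub>R partial c l x p))"
    by (simp add: null_trace_def linear_sum[OF linear_mink_right] mink_simps sum_distrib_left
        sum_distrib_right algebra_simps sum.distrib sum_subtractf sum_negf)
  finally show ?thesis
    by (simp add: differential_partial_sum[OF smooth_x p, symmetric] differential_x_E p)
qed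

text \<open>The Christoffel terms complete the derivative of the components of \<open>V\<close> to the tangential part of
  the flat derivative of the ambient vector field \<open>dx (V)\<close>, whose trace is then taken in the frame.\<close>

lemma divergence_null_frame:
  assumes V: "\<And>i. smooth (\<lambda>q. V q $ i)" and p: "p \<in> fst c"
  shows "divergence c x V p =
    null_trace (\<lambda>a b. mink (D a (\<lambda>q. differential c x q (V q)) p) (e b p))"
proof -
  define dV :: "real^4^4" where "dV = (\<chi> m i. partial c i (\<lambda>q. V q $ m) p)"
  have "D a (\<lambda>q. differential c x q (V q)) p = differential c x p (dV *v E a p)
      + (\<Sum>i\<in>UNIV. \<Sum>m\<in>UNIV. (V p $ m * E a p $ i) *\<^sub>R partial c i (partial c m x) p)" for a
  proof -
    have "D a (\<lambda>q. differential c x q (V q)) p = D a (\<lambda>q. \<Sum>m\<in>UNIV. V q $ m *\<^sub>R partial c m x q) p"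
      by (rule D_cong_domain[OF p]) (rule differential_partial_sum[OF smooth_x])
    also have "\<dots> = (\<Sum>m\<in>UNIV. D a (\<lambda>q. V q $ m) p *\<^sub>R partial c m x p) +
        (\<Sum>m\<in>UNIV. V p $ m *\<^sub>R D a (partial c m x) p)"
      by (simp add: D_sum V p D_scaleR smooth_scaleR smooth_partial smooth_x sum.distrib)
    also have "(\<Sum>m\<in>UNIV. D a (\<lambda>q. V q $ m) p *\<^sub>R partial c m x p) = differential c x p (dV *v E a p)"
      by (simp add: differential_partial_sum[OF smooth_x p] D_partial_sum[OF V p] dV_def
          matrix_vector_mult_def mult.commute)
    also have "(\<Sum>m\<in>UNIV. V p $ m *\<^sub>R D a (partial c m x) p) =
        (\<Sum>m\<in>UNIV. \<Sum>i\<in>UNIV. (V p $ m * E a p $ i) *\<^sub>R partial c i (partial c m x) p)"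
      by (simp add: D_partial_sum[OF smooth_partial[OF smooth_x] p] scaleR_sum_right)
    also have "(\<Sum>m\<in>UNIV. \<Sum>i\<in>UNIV. (V p $ m * E a p $ i) *\<^sub>R partial c i (partial c m x) p) =
        (\<Sum>i\<in>UNIV. \<Sum>m\<in>UNIV. (V p $ m * E a p $ i) *\<^sub>R partial c i (partial c m x) p)"
      by (rule sum.swap)
    finally show ?thesis .
  qed
  then have "null_trace (\<lambda>a b. mink (D a (\<lambda>q. differential c x q (V q)) p) (e b p)) =
      null_trace (\<lambda>a b. mink (differential c x p (dV *v E a p)) (e b p)) +
      null_trace (\<lambda>a b. \<Sum>i\<in>UNIV. \<Sum>m\<in>UNIV.
        (V p $ m * E a p $ i) * mink (partial c i (partial c m x) p) (e b p))"
    by (simp add: null_trace_add[symmetric] mink_simps linear_sum[OF linear_mink_left])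
  also have "\<dots> = (\<Sum>i\<in>UNIV. dV $ i $ i) +
      (\<Sum>i\<in>UNIV. \<Sum>m\<in>UNIV. christoffel c x i i m p * V p $ m)"
    unfolding trace_null_frame[OF p] null_trace_sum
    by (simp add: christoffel_null_frame[OF p] null_trace_def algebra_simps)
  also have "\<dots> = divergence c x V p"
    by (simp add: divergence_def dV_def sum.distrib)
  finally show ?thesis by simp
qed

text \<open>\<open>frame_div m\<close> is the divergence of the tangent field \<open>e m\<close>, and \<open>box\<close> is \<open>div \<nabla> = - \<Delta>\<close>,
  defined for vector-valued functions as well.\<close>

definition frame_div :: "4 \<Rightarrow> 'm \<Rightarrow> real" where
  "frame_div m p = null_trace (\<lambda>a b. w a m b p)"

definition box :: "('m \<Rightarrow> 'b::real_normed_vector) \<Rightarrow> 'm \<Rightarrow> 'b" where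
  "box f p = null_trace (\<lambda>a b. D a (D b f) p) + null_trace (\<lambda>a b. frame_div a p *\<^sub>R D b f p)"

lemma laplacian_null_frame:
  assumes f: "smooth f" and p: "p \<in> fst c"
  shows "laplacian c x f p = - box f p"
proof -
  have V: "smooth (\<lambda>q. gradient c x f q $ i)" for i
  proof -
    have "smooth (\<lambda>q. null_trace (\<lambda>a b. D b f q * E a q $ i))"
      by (intro smooth_null_trace smooth_mult smooth_D smooth_E f)
    then show ?thesis
      by (subst smooth_cong[of _ "\<lambda>q. null_trace (\<lambda>a b. D b f q * E a q $ i)"])
        (simp_all add: gradient_null_frame f null_trace_def)
  qed
  have "D a (\<lambda>q. differential c x q (gradient c x f q)) p =
      D a (\<lambda>q. null_trace (\<lambda>m n. D n f q *\<^sub>R e m q)) p" for a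
    by (rule D_cong_domain[OF p])
      (simp add: gradient_null_frame[OF f] null_trace_linear[OF linear_dx] dx_simps differential_x_E)
  also have "D a (\<lambda>q. null_trace (\<lambda>m n. D n f q *\<^sub>R e m q)) p =
      null_trace (\<lambda>m n. D a (D n f) p *\<^sub>R e m p + D n f p *\<^sub>R D a (e m) p)" for a
    by (simp add: D_null_trace smooth_scaleR smooth_D f smooth_e p D_scaleR)
  finally have "laplacian c x f p = - null_trace (\<lambda>a b. null_trace (\<lambda>m n.
      D a (D n f) p * gram m b + D n f p * w a m b p))"
    by (simp add: laplacian_def divergence_null_frame[OF V p] null_trace_linear[OF linear_mink_left]
        mink_simps frame_gram p w_def)
  also have "\<dots> = - box f p"
    by (simp add: box_def frame_div_def null_trace_def algebra_simps)
  finally show ?thesis .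
qed

lemma box_nth:
  fixes f :: "'m \<Rightarrow> real^'n"
  assumes f: "smooth f" and p: "p \<in> fst c"
  shows "box (\<lambda>q. f q $ m) p = box f p $ m"
proof -
  have "D a (D b (\<lambda>q. f q $ m)) p = D a (D b f) p $ m" for a b
  proof -
    have "D a (D b (\<lambda>q. f q $ m)) p = D a (\<lambda>q. D b f q $ m) p"
      by (rule D_cong_domain[OF p]) (rule D_nth[OF f])
    then show ?thesis by (simp add: D_nth[OF smooth_D[OF f] p])
  qed
  then show ?thesis
    by (simp add: box_def D_nth[OF f p] null_trace_def)
qed

lemma box_scaleR:
  fixes f :: "'m \<Rightarrow> 'b::real_normed_vector" and s :: "'m \<Rightarrow> real"
  assumes s: "smooth s" and f: "smooth f" and p: "p \<in> fst c"
  shows "box (\<lambda>q. s q *\<^sub>R f q) p = box s p *\<^sub>R f p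
    + 2 *\<^sub>R null_trace (\<lambda>a b. D a s p *\<^sub>R D b f p) + s p *\<^sub>R box f p"
proof -
  have "D a (D b (\<lambda>q. s q *\<^sub>R f q)) p = D a (D b s) p *\<^sub>R f p + D b s p *\<^sub>R D a f p
      + D a s p *\<^sub>R D b f p + s p *\<^sub>R D a (D b f) p" for a b
  proof -
    have "D a (D b (\<lambda>q. s q *\<^sub>R f q)) p = D a (\<lambda>q. D b s q *\<^sub>R f q + s q *\<^sub>R D b f q) p"
      by (rule D_cong_domain[OF p]) (rule D_scaleR[OF s f])
    then show ?thesis
      by (simp add: D_add D_scaleR smooth_scaleR smooth_D s f p)
  qed
  then show ?thesis
    unfolding scaleR_2 by (simp add: box_def D_scaleR s f p null_trace_def algebra_simps)
qed

lemma laplacian_cong: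
  assumes "\<And>q. q \<in> fst c \<Longrightarrow> f q = g q" "smooth g" "p \<in> fst c"
  shows "laplacian c x f p = laplacian c x g p"
proof -
  have f: "smooth f"
    using assms(1,2) smooth_cong[of f g] by blast
  have "D b f q = D b g q" if "q \<in> fst c" for b q
    by (rule D_cong_domain[OF that assms(1)])
  moreover from this have "D a (D b f) p = D a (D b g) p" for a b
    by (rule D_cong_domain[OF assms(3)])
  ultimately show ?thesis
    using assms(3) by (simp add: laplacian_null_frame f assms(2) box_def)
qed

end

section \<open>Second fundamental form, Codazzi equation and the biharmonic equations\<close>

context null_framed_chart
begin

text \<open>The second fundamental form and its trace. As \<open>\<langle>e\<^sub>j, N\<rangle> = 0\<close>, it equals \<open>\<langle>S e\<^sub>i, e\<^sub>j\<rangle>\<close>.\<close>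

definition h :: "4 \<Rightarrow> 4 \<Rightarrow> 'm \<Rightarrow> real" where
  "h i j p = mink (D i (e j) p) (N p)"

definition H :: "'m \<Rightarrow> real" where
  "H p = null_trace (\<lambda>i j. h i j p)"

lemma smooth_h: "smooth (h i j)"
  using smooth_mink[OF smooth_D[OF smooth_e] smooth_N] by (simp add: h_def[abs_def])

lemma smooth_H: "smooth H"
  using smooth_null_trace[of h, OF smooth_h] by (simp add: H_def[abs_def])

lemma differential_normal_tangent:
  assumes p: "p \<in> fst c"
  shows "mink (differential c N p v) (N p) = 0"
proof -
  have "differential c (\<lambda>q. mink (N q) (N q)) p v = differential c (\<lambda>q. 1::real) p v"
    by (simp add: differential_cong[OF chart_open_domain p normal_unit])
  then show ?thesis
    by (simp add: differential_bilinear[OF bounded_bilinear_mink] smooth_N p differential_const mink_commute)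
qed

lemma D_normal_inner_normal: "p \<in> fst c \<Longrightarrow> mink (D i N p) (N p) = 0"
  by (simp add: D_def differential_normal_tangent)

lemma D_normal_inner_frame:
  assumes p: "p \<in> fst c"
  shows "mink (D i N p) (e j p) = - h i j p"
proof -
  have "D i (\<lambda>q. mink (e j q) (N q)) p = D i (\<lambda>q. 0::real) p"
    by (rule D_cong_domain[OF p frame_normal])
  then have "mink (D i (e j) p) (N p) + mink (e j p) (D i N p) = 0"
    by (simp add: D_mink smooth_e smooth_N p D_const)
  then show ?thesis
    by (simp add: h_def mink_commute[of "e j p"])
qed

lemma D_frame_inner_D_normal:
  assumes p: "p \<in> fst c"
  shows "mink (D i (e j) p) (D m N p) = - null_trace (\<lambda>a b. w i j a p * h m b p)"
  unfolding mink_expansion[OF p, of "D i (e j) p" "D m N p"]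
  by (simp add: D_normal_inner_normal[OF p] D_normal_inner_frame[OF p] w_def null_trace_def)

text \<open>The difference of the two entries is the normal part of a Lie bracket of tangent fields.\<close>

lemma h_sym:
  assumes p: "p \<in> fst c"
  shows "h i j p = h j i p"
proof -
  have "mink (N p) (D i (e j) p - D j (e i) p) = 0"
    using normal_tangent[OF p, of "bracket i j p"] by (simp add: differential_x_bracket[OF p])
  then show ?thesis
    by (simp add: h_def mink_simps mink_commute)
qed

text \<open>The covariant derivative \<open>(\<nabla>\<^sub>e\<^sub>i h) (e\<^sub>j, e\<^sub>m)\<close> of the second fundamental form. Since
  \<open>D m N = - S e\<^sub>m\<close> is tangent, flat derivatives may replace covariant ones in the last two terms.\<close>

definition C :: "4 \<Rightarrow> 4 \<Rightarrow> 4 \<Rightarrow> 'm \<Rightarrow> real" where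
  "C i j m p = D i (h j m) p + mink (D i (e j) p) (D m N p) + mink (D j N p) (D i (e m) p)"

lemma D_D_normal_inner_frame:
  assumes p: "p \<in> fst c"
  shows "mink (D i (D j N) p) (e m p) = - D i (h j m) p - mink (D j N p) (D i (e m) p)"
proof -
  have "D i (\<lambda>q. mink (D j N q) (e m q)) p = D i (\<lambda>q. - h j m q) p"
    by (rule D_cong_domain[OF p D_normal_inner_frame])
  then show ?thesis
    by (simp add: D_mink smooth_D smooth_N smooth_e p D_minus smooth_h)
qed

lemma C_sym:
  assumes p: "p \<in> fst c"
  shows "C i j m p = C i m j p"
proof -
  have "D i (h j m) p = D i (h m j) p"
    by (rule D_cong_domain[OF p h_sym])
  then show ?thesis by (simp add: C_def mink_commute)
qed

text \<open>The commutator of \<open>D i\<close> and \<open>D j\<close> on the normal. Together with \<open>C_sym\<close> it makes \<open>C\<close> totally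
  symmetric.\<close>

lemma codazzi:
  assumes p: "p \<in> fst c"
  shows "C i j m p = C j i m p"
proof -
  have C: "C i j m p = mink (D i (e j) p) (D m N p) - mink (D i (D j N) p) (e m p)" for i j
    by (simp add: C_def D_D_normal_inner_frame[OF p])
  have "mink (D i (D j N) p - D j (D i N) p) (e m p) =
      null_trace (\<lambda>a b. (w i j b p - w j i b p) * - h a m p)"
    unfolding commutator[OF smooth_N p]
    by (simp add: null_trace_linear[OF linear_mink_left] mink_simps D_normal_inner_frame[OF p])
  also have "\<dots> = mink (D i (e j) p - D j (e i) p) (D m N p)"
    by (simp add: mink_simps D_frame_inner_D_normal[OF p] null_trace_def h_sym[OF p, of _ m] algebra_simps)
  finally show ?thesis by (simp add: C mink_simps)
qed

text \<open>Metric contractions commute with covariant derivatives: the connection terms cancel since the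
  connection coefficients are antisymmetric and the second fundamental form is symmetric.\<close>

lemma null_trace_C:
  assumes p: "p \<in> fst c"
  shows "null_trace (\<lambda>a b. C m a b p) = D m H p"
proof -
  have "D m H p = null_trace (\<lambda>a b. D m (h a b) p)"
    unfolding H_def[abs_def] by (rule D_null_trace[OF smooth_h p])
  moreover have "w m a a p = 0" for a
    using w_antisym[OF p, of m a a] by simp
  ultimately show ?thesis
    using w_antisym[OF p, of m 2 1] w_antisym[OF p, of m 3 1] w_antisym[OF p, of m 4 1]
      w_antisym[OF p, of m 3 2] w_antisym[OF p, of m 4 2] w_antisym[OF p, of m 4 3]
    by (simp add: C_def null_trace_def mink_commute[of "D _ N p"] D_frame_inner_D_normal[OF p]
        h_sym[OF p, of 2 1] h_sym[OF p, of 3 1]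
        h_sym[OF p, of 4 1] h_sym[OF p, of 3 2] h_sym[OF p, of 4 2] h_sym[OF p, of 4 3] algebra_simps)
qed

text \<open>Differentiating the constant products \<open>\<langle>e\<^sub>a, e\<^sub>b\<rangle>\<close> moves the derivative: in the frame, the first-order term
  of \<open>box f\<close> is minus the derivative of \<open>f\<close> along the contraction of \<open>\<nabla>\<^sub>e\<^sub>a e\<^sub>b\<close>.\<close>

lemma frame_div_inner:
  assumes p: "p \<in> fst c"
  shows "null_trace (\<lambda>a b. frame_div a p * mink Z (e b p)) =
    - null_trace (\<lambda>a b. null_trace (\<lambda>i j. w a b i p * mink Z (e j p)))"
proof -
  have "w m a a p = 0" for m a
    using w_antisym[OF p, of m a a] by simp
  then show ?thesis
    using w_antisym[OF p, of _ 2 1] w_antisym[OF p, of _ 3 1] w_antisym[OF p, of _ 4 1]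
      w_antisym[OF p, of _ 3 2] w_antisym[OF p, of _ 4 2] w_antisym[OF p, of _ 4 3]
    by (simp add: frame_div_def null_trace_def algebra_simps)
qed

text \<open>Beltrami's formula for the position vector.\<close>

lemma box_x:
  assumes p: "p \<in> fst c"
  shows "box x p = H p *\<^sub>R N p"
proof -
  have "D a (D b x) p = D a (e b) p" for a b
    by (rule D_cong_domain[OF p D_x])
  then have box: "box x p = null_trace (\<lambda>a b. D a (e b) p) + null_trace (\<lambda>a b. frame_div a p *\<^sub>R e b p)"
    by (simp add: box_def D_x p)
  have frame: "mink (box x p) (e m p) = 0" for m
    using frame_div_inner[OF p, of "e m p"]
    by (simp add: box mink_simps null_trace_linear[OF linear_mink_left]
        null_trace_gram w_def frame_gram[OF p])
  have "mink (box x p) (N p) = H p"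
    by (simp add: box mink_simps null_trace_linear[OF linear_mink_left] frame_normal p h_def H_def)
      (simp add: null_trace_def)
  with frame show ?thesis
    using ambient_expansion[OF p, of "box x p"] by (simp add: null_trace_def)
qed

text \<open>The tangential part of \<open>box N\<close> is minus the divergence of \<open>S\<close>, which by the Codazzi equation is the
  gradient of its trace.\<close>

lemma box_normal_inner_frame:
  assumes p: "p \<in> fst c"
  shows "mink (box N p) (e m p) = - D m H p"
proof -
  have "null_trace (\<lambda>a b. frame_div a p * mink (D b N p) (e m p)) =
      null_trace (\<lambda>a b. frame_div a p * mink (D m N p) (e b p))"
    by (simp add: D_normal_inner_frame[OF p] h_sym[OF p, of _ m])
  also have "\<dots> = - null_trace (\<lambda>a b. mink (D a (e b) p) (D m N p))"
    unfolding frame_div_inner[OF p]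
    by (simp add: D_frame_inner_D_normal[OF p] D_normal_inner_frame[OF p] null_trace_def)
  finally have "mink (box N p) (e m p) = - null_trace (\<lambda>a b. C a b m p)"
    by (simp add: box_def C_def mink_simps null_trace_linear[OF linear_mink_left]
        D_D_normal_inner_frame[OF p]) (simp add: null_trace_def)
  also have "\<dots> = - null_trace (\<lambda>a b. C m a b p)"
    by (simp only: C_sym[OF p, of _ _ m] codazzi[OF p, of _ m])
  finally show ?thesis by (simp add: null_trace_C[OF p])
qed

lemma box_normal_inner_normal:
  assumes p: "p \<in> fst c"
  shows "mink (box N p) (N p) = - null_trace (\<lambda>a b. mink (D a N p) (D b N p))"
proof -
  have "mink (D a (D b N) p) (N p) = - mink (D b N p) (D a N p)" for a b
  proof -
    have "D a (\<lambda>q. mink (D b N q) (N q)) p = D a (\<lambda>q. 0::real) p"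
      by (rule D_cong_domain[OF p D_normal_inner_normal])
    then show ?thesis
      by (simp add: D_mink smooth_D smooth_N p D_const)
  qed
  then show ?thesis
    by (simp add: box_def mink_simps null_trace_linear[OF linear_mink_left] D_normal_inner_normal p)
      (simp add: null_trace_def mink_commute)
qed

lemma laplacian_immersion:
  "p \<in> fst c \<Longrightarrow> laplacian c x (\<lambda>q. x q $ a) p = - (H p * N p $ a)"
  by (simp add: laplacian_null_frame smooth_nth smooth_x box_nth box_x)

lemma bilaplacian_immersion:
  assumes p: "p \<in> fst c"
  shows "laplacian c x (laplacian c x (\<lambda>q. x q $ a)) p = box (\<lambda>q. H q *\<^sub>R N q) p $ a"
proof -
  have s: "smooth (\<lambda>q. H q *\<^sub>R N q)"
    by (intro smooth_scaleR smooth_H smooth_N)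
  have s1: "smooth (\<lambda>q. (-1) *\<^sub>R (H q *\<^sub>R N q))"
    by (intro smooth_scaleR s smooth_const)
  have "laplacian c x (laplacian c x (\<lambda>q. x q $ a)) p =
      laplacian c x (\<lambda>q. ((-1) *\<^sub>R (H q *\<^sub>R N q)) $ a) p"
    by (rule laplacian_cong) (simp_all add: laplacian_immersion p smooth_nth[OF s1, simplified])
  also have "\<dots> = - box (\<lambda>q. (-1) *\<^sub>R (H q *\<^sub>R N q)) p $ a"
    by (simp only: laplacian_null_frame[OF smooth_nth[OF s1] p] box_nth[OF s1 p])
  also have "box (\<lambda>q. (-1) *\<^sub>R (H q *\<^sub>R N q)) p = - box (\<lambda>q. H q *\<^sub>R N q) p"
    by (subst box_scaleR[OF smooth_const s p]) (simp add: box_def D_const[abs_def] null_trace_def)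
  finally show ?thesis by simp
qed

text \<open>The product rule leaves three terms: a normal one, the tangential \<open>- 2 S (\<nabla>H)\<close>, and \<open>H\<close> times
  \<open>box N\<close>, whose two parts are known.\<close>

lemma biharmonic_normal_tangential:
  assumes p: "p \<in> fst c" and zero: "box (\<lambda>q. H q *\<^sub>R N q) p = 0"
  shows "box H p = H p * null_trace (\<lambda>a b. mink (D a N p) (D b N p))"
    and "2 * null_trace (\<lambda>a b. D a H p * h b m p) + H p * D m H p = 0"
proof -
  have b: "box H p *\<^sub>R N p + 2 *\<^sub>R null_trace (\<lambda>a b. D a H p *\<^sub>R D b N p) + H p *\<^sub>R box N p = 0"
    using box_scaleR[OF smooth_H smooth_N p] zero by simp
  have "mink (box H p *\<^sub>R N p + 2 *\<^sub>R null_trace (\<lambda>a b. D a H p *\<^sub>R D b N p) + H p *\<^sub>R box N p) (N p) = 0"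
    unfolding b by (simp add: mink_simps)
  then show "box H p = H p * null_trace (\<lambda>a b. mink (D a N p) (D b N p))"
    by (simp add: mink_simps null_trace_linear[OF linear_mink_left] D_normal_inner_normal p
        normal_unit box_normal_inner_normal) (simp add: null_trace_def)
  have "mink (box H p *\<^sub>R N p + 2 *\<^sub>R null_trace (\<lambda>a b. D a H p *\<^sub>R D b N p) + H p *\<^sub>R box N p) (e m p) = 0"
    unfolding b by (simp add: mink_simps)
  then show "2 * null_trace (\<lambda>a b. D a H p * h b m p) + H p * D m H p = 0"
    by (simp add: mink_simps null_trace_linear[OF linear_mink_left] D_normal_inner_frame p
        normal_frame box_normal_inner_frame) (simp add: null_trace_def)
qed

text \<open>The coordinate definition of the trace involves the map \<open>u\<close> that sends the components of a tangent
  vector to those of its image under \<open>S\<close>; expanding \<open>u\<close> in the frame shows that it is linear, so that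
  its matrix represents it.\<close>

lemma mean_curvature_null_frame:
  assumes p: "p \<in> fst c"
  shows "mean_curvature c x N p = H p"
proof -
  define u where "u v = null_trace (\<lambda>i j. mink (- differential c N p v) (e j p) *\<^sub>R E i p)" for v
  have dN: "linear (differential c N p)"
    by (rule linear_differential[OF smooth_N p])
  have dx_u: "differential c x p (u v) = - differential c N p v" for v
  proof -
    have "differential c x p (u v) = null_trace (\<lambda>i j. mink (- differential c N p v) (e j p) *\<^sub>R e i p)"
      by (simp add: u_def null_trace_linear[OF linear_dx[OF p]] dx_simps p differential_x_E)
    moreover have "mink (- differential c N p v) (N p) = 0"
      by (simp add: mink_simps differential_normal_tangent[OF p])
    ultimately show ?thesis
      using ambient_expansion[OF p, of "- differential c N p v"] by simp
  qed
  have "linear u"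
    by (rule linearI) (simp_all add: u_def null_trace_def linear_add[OF dN] linear_scale[OF dN]
        mink_simps algebra_simps)
  moreover have "components c x p (shape_operator c x N p (differential c x p v)) = u v" for v
    by (simp add: shape_operator_def flat_deriv_def components_differential[OF p]
        flip: dx_u)
  ultimately have "mean_curvature c x N p =
      null_trace (\<lambda>a b. mink (differential c x p (u (E a p))) (e b p))"
    using trace_null_frame[OF p, of "matrix u"]
    by (simp add: mean_curvature_def trace_def matrix_works)
  also have "\<dots> = H p"
    by (simp add: dx_u mink_simps H_def D_def[symmetric] D_normal_inner_frame[OF p])
  finally show ?thesis .
qed

end

section \<open>The shape operator with a nilpotent block of order three\<close>

locale nilpotent_block_chart = null_framed_chart c x N e
  for c :: "'m chart" and x N :: "'m \<Rightarrow> real^5" and e :: "4 \<Rightarrow> 'm \<Rightarrow> real^5" +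
  fixes k l :: "'m \<Rightarrow> real"
  assumes smooth_k: "smooth k" and smooth_l: "smooth l"
    and shape:
      "p \<in> fst c \<Longrightarrow> shape_operator c x N p (e 1 p) = k p *\<^sub>R e 1 p - e 3 p"
      "p \<in> fst c \<Longrightarrow> shape_operator c x N p (e 2 p) = k p *\<^sub>R e 2 p"
      "p \<in> fst c \<Longrightarrow> shape_operator c x N p (e 3 p) = e 2 p + k p *\<^sub>R e 3 p"
      "p \<in> fst c \<Longrightarrow> shape_operator c x N p (e 4 p) = l p *\<^sub>R e 4 p"
begin

lemma D_normal_shape: "D i N p = - shape_operator c x N p (e i p)"
  by (simp add: shape_operator_def flat_deriv_def D_def E_def)

lemma h_shape: "p \<in> fst c \<Longrightarrow> h i j p = mink (shape_operator c x N p (e i p)) (e j p)"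
  using D_normal_inner_frame[of p i j] by (simp add: D_normal_shape mink_simps)

lemma h_table:
  assumes "p \<in> fst c"
  shows "h 1 1 p = 0" "h 1 2 p = - k p" "h 1 3 p = -1" "h 1 4 p = 0"
    "h 2 1 p = - k p" "h 2 2 p = 0" "h 2 3 p = 0" "h 2 4 p = 0"
    "h 3 1 p = -1" "h 3 2 p = 0" "h 3 3 p = k p" "h 3 4 p = 0"
    "h 4 1 p = 0" "h 4 2 p = 0" "h 4 3 p = 0" "h 4 4 p = l p"
  using assms by (simp_all add: h_shape shape mink_simps frame_gram)

lemma H_eq: "p \<in> fst c \<Longrightarrow> H p = 3 * k p + l p"
  by (simp add: H_def null_trace_def h_table)

lemma trace_shape_squared:
  "p \<in> fst c \<Longrightarrow> null_trace (\<lambda>a b. mink (D a N p) (D b N p)) = 3 * (k p)\<^sup>2 + (l p)\<^sup>2"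
  by (simp add: null_trace_def D_normal_shape shape mink_simps frame_gram power2_eq_square)

lemma w_diag: "p \<in> fst c \<Longrightarrow> w i j j p = 0"
  using w_antisym[of p i j j] by simp

lemma w_swap:
  assumes "p \<in> fst c"
  shows "w i 2 1 p = - w i 1 2 p" "w i 3 1 p = - w i 1 3 p" "w i 4 1 p = - w i 1 4 p"
    "w i 3 2 p = - w i 2 3 p" "w i 4 2 p = - w i 2 4 p" "w i 4 3 p = - w i 3 4 p"
  using w_antisym[OF assms] by blast+

text \<open>On the span of \<open>e1, e2, e3\<close> the operator \<open>S\<close> is \<open>k\<close> plus a nilpotent part that is constant in the
  frame. The multiple of the identity cancels in the entries without \<open>e4\<close>, up to the derivative of \<open>k\<close>, and
  leaves the factor \<open>k - l\<close> in those with one \<open>e4\<close>; the remaining terms come from the nilpotent part.\<close>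

lemma C_table:
  assumes p: "p \<in> fst c"
  shows "C i 1 1 p = 2 * w i 1 3 p" "C i 1 2 p = w i 2 3 p - D i k p" "C i 1 3 p = - w i 1 2 p"
    "C i 1 4 p = (k p - l p) * w i 1 4 p - w i 3 4 p" "C i 2 2 p = 0" "C i 2 3 p = 0"
    "C i 2 4 p = (k p - l p) * w i 2 4 p" "C i 3 3 p = D i k p + 2 * w i 2 3 p"
    "C i 3 4 p = (k p - l p) * w i 3 4 p + w i 2 4 p" "C i 4 4 p = D i l p"
proof -
  have "D i (h 1 2) p = D i (\<lambda>q. - k q) p"
    by (rule D_cong_domain[OF p h_table(2)])
  then have Dh: "D i (h 1 2) p = - D i k p"
    by (simp add: D_minus[OF smooth_k p])
  have Dh': "D i (h 3 3) p = D i k p" "D i (h 4 4) p = D i l p"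
    by (rule D_cong_domain[OF p], erule h_table)+
  have Dh0: "D i (h 1 1) p = 0" "D i (h 1 3) p = 0" "D i (h 1 4) p = 0" "D i (h 2 2) p = 0"
    "D i (h 2 3) p = 0" "D i (h 2 4) p = 0" "D i (h 3 4) p = 0"
    by (rule D_locally_const[OF chart_open_domain p], erule h_table)+
  show "C i 1 1 p = 2 * w i 1 3 p" "C i 1 2 p = w i 2 3 p - D i k p" "C i 1 3 p = - w i 1 2 p"
    "C i 1 4 p = (k p - l p) * w i 1 4 p - w i 3 4 p" "C i 2 2 p = 0" "C i 2 3 p = 0"
    "C i 2 4 p = (k p - l p) * w i 2 4 p" "C i 3 3 p = D i k p + 2 * w i 2 3 p"
    "C i 3 4 p = (k p - l p) * w i 3 4 p + w i 2 4 p" "C i 4 4 p = D i l p"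
    by (simp_all add: C_def Dh Dh' Dh0 mink_commute[of "D _ N p"] D_frame_inner_D_normal[OF p] null_trace_def
        h_table[OF p] w_diag[OF p] w_swap[OF p] algebra_simps)
qed

text \<open>Consequences of total symmetry inside the block of \<open>e1, e2, e3\<close>. In particular \<open>k\<close> is constant along
  the null eigendirection \<open>e2\<close>: the entries \<open>(2; 1, 2)\<close> and \<open>(2; 3, 3)\<close> vanish, and they give
  \<open>w 2 2 3 = D 2 k\<close> and \<open>D 2 k = - 2 w 2 2 3\<close>.\<close>

lemma codazzi_always:
  assumes p: "p \<in> fst c"
  shows "w 2 2 3 p = D 2 k p" "D 2 k p = 0" "w 3 2 3 p = D 3 k p"
  using codazzi[OF p, of 1 2 2] codazzi[OF p, of 2 3 3] codazzi[OF p, of 1 3 2]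
    C_sym[OF p, of _ 2 1] C_sym[OF p, of _ 3 2] C_sym[OF p, of _ 3 1]
  by (simp_all add: C_table[OF p])

text \<open>Consequences that involve \<open>e4\<close>. The distinctness of the eigenvalues makes it possible to divide by
  \<open>k - l\<close>.\<close>

lemma codazzi_distinct:
  assumes p: "p \<in> fst c" and kl: "k p \<noteq> l p"
  shows "w 2 2 4 p = 0" "w 3 2 4 p = 0" "w 2 3 4 p = 0"
    "w 4 2 3 p - D 4 k p = (k p - l p) * w 2 1 4 p"
    "w 2 1 4 p = w 1 2 4 p"
    "D 4 k p + 2 * w 4 2 3 p = (k p - l p) * w 3 3 4 p"
    "(k p - l p) * w 1 3 4 p + w 1 2 4 p = (k p - l p) * w 3 1 4 p - w 3 3 4 p"
    "(k p - l p) * w 4 1 4 p - w 4 3 4 p = D 1 l p"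
    "(k p - l p) * w 4 2 4 p = D 2 l p"
    "(k p - l p) * w 4 3 4 p + w 4 2 4 p = D 3 l p"
proof -
  note C = C_table[OF p] and cod = codazzi[OF p] and sym = C_sym[OF p]
  have d: "k p - l p \<noteq> 0" using kl by simp
  show 1: "w 2 2 4 p = 0"
    using cod[of 2 4 2] sym[of 2 4 2] C(5)[of 4] C(7)[of 2] d by simp
  show 2: "w 3 2 4 p = 0"
    using cod[of 3 4 2] sym[of 3 4 2] sym[of 4 3 2] C(6)[of 4] C(7)[of 3] d by simp
  show 3: "w 2 3 4 p = 0"
    using cod[of 2 4 3] sym[of 2 4 3] C(6)[of 4] C(9)[of 2] 1 d by simp
  show "w 4 2 3 p - D 4 k p = (k p - l p) * w 2 1 4 p"
    using cod[of 4 2 1] sym[of 4 2 1] sym[of 2 4 1] C(2)[of 4] C(4)[of 2] 3 by simp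
  show "w 2 1 4 p = w 1 2 4 p"
    using cod[of 2 1 4] C(4)[of 2] C(7)[of 1] 3 d by simp
  show "D 4 k p + 2 * w 4 2 3 p = (k p - l p) * w 3 3 4 p"
    using cod[of 4 3 3] sym[of 3 4 3] C(8)[of 4] C(9)[of 3] 2 by simp
  show "(k p - l p) * w 1 3 4 p + w 1 2 4 p = (k p - l p) * w 3 1 4 p - w 3 3 4 p"
    using cod[of 1 3 4] C(4)[of 3] C(9)[of 1] by simp
  show "(k p - l p) * w 4 1 4 p - w 4 3 4 p = D 1 l p"
    using cod[of 4 1 4] C(4)[of 4] C(10)[of 1] by simp
  show "(k p - l p) * w 4 2 4 p = D 2 l p"
    using cod[of 4 2 4] C(7)[of 4] C(10)[of 2] by simp
  show "(k p - l p) * w 4 3 4 p + w 4 2 4 p = D 3 l p"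
    using cod[of 4 3 4] C(9)[of 4] C(10)[of 3] by simp
qed

text \<open>The case of a gradient along the null eigenvector \<open>e2\<close>, in which only the derivative of \<open>k\<close> along
  \<open>e1\<close> is nonzero. All coefficients \<open>w i 2 4\<close> vanish, so \<open>\<langle>R(e1, e4) e2, e4\<rangle>\<close> could only come from the products
  \<open>w 1 2 3 * w 4 4 3\<close> and \<open>w 4 2 3 * w 1 4 3\<close>, in which \<open>w 4 4 3\<close> and \<open>w 4 2 3\<close> vanish too. The
  second fundamental form, however, contributes \<open>h 1 2 * h 4 4 = - k * l\<close>.\<close>

lemma null_gradient_impossible:
  assumes V: "chart_open V" "p \<in> V"
    and l: "\<And>q. q \<in> V \<Longrightarrow> l q = - 5 * k q"
    and k: "\<And>q. q \<in> V \<Longrightarrow> k q \<noteq> 0"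
    and D1: "\<And>q. q \<in> V \<Longrightarrow> D 1 k q \<noteq> 0"
    and D3: "\<And>q. q \<in> V \<Longrightarrow> D 3 k q = 0"
    and D4: "\<And>q. q \<in> V \<Longrightarrow> D 4 k q = 0"
  shows False
proof -
  have van: "w 2 2 3 q = 0 \<and> w 3 2 3 q = 0 \<and> w 4 2 3 q = 0 \<and> w 1 2 4 q = 0 \<and> w 2 2 4 q = 0 \<and>
      w 3 2 4 q = 0 \<and> w 4 2 4 q = 0 \<and> w 4 3 4 q = 0" if q: "q \<in> V" for q
  proof -
    note qc = chart_open_subset[OF V(1) q]
    have kl: "k q \<noteq> l q" "k q - l q = 6 * k q" using l[OF q] k[OF q] by auto
    note cod = codazzi_always[OF qc] codazzi_distinct[OF qc kl(1)]
    have Dl: "D i l q = - 5 * D i k q" for i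
    proof -
      have "D i l q = D i (\<lambda>q. - 5 * k q) q"
        by (rule D_cong[OF V(1) q]) (rule l)
      also have "\<dots> = - 5 * D i k q"
        by (rule D_cmult[OF smooth_k qc])
      finally show ?thesis .
    qed
    have zero: "D i (D 3 k) q = 0" "D i (D 4 k) q = 0" for i
      by (rule D_locally_const[OF V(1) q], erule D3 D4)+
    \<comment> \<open>Both iterated derivatives of \<open>k\<close> vanish, so the bracket of \<open>e3\<close> and \<open>e4\<close> has no \<open>e1\<close> component.\<close>
    have w423: "w 4 2 3 q = 0"
      using commutator[OF smooth_k qc, of 3 4] D1[OF q]
      by (simp add: zero null_trace_def cod D3[OF q] D4[OF q] w_swap[OF qc])
    have "w 4 2 4 q = 0" "w 1 2 4 q = 0"
      using cod w423 k[OF q] D4[OF q] by (simp_all add: kl(2) Dl)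
    moreover from this have "w 4 3 4 q = 0"
      using cod k[OF q] D3[OF q] by (simp add: kl(2) Dl)
    ultimately show ?thesis using cod w423 D3[OF q] by simp
  qed
  note p = chart_open_subset[OF V]
  have "D i (w j 2 4) p = D i (\<lambda>q. 0::real) p" for i j
    by (rule D_cong[OF V]) (use van exhaust_4[of j] in auto)
  then have "D i (\<lambda>q. mink (D j (e 2) q) (e 4 q)) p = 0" for i j
    by (simp add: w_def[abs_def] D_const)
  then have "mink (D i (D j (e 2)) p) (e 4 p) = - mink (D j (e 2) p) (D i (e 4) p)" for i j
    by (simp add: D_mink smooth_D smooth_e p eq_neg_iff_add_eq_0)
  then have "mink (D 1 (e 2) p) (D 4 (e 4) p) - mink (D 4 (e 2) p) (D 1 (e 4) p) =
      mink (D 1 (D 4 (e 2)) p - D 4 (D 1 (e 2)) p) (e 4 p)"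
    by (simp add: mink_simps)
  also have "\<dots> = 0"
    unfolding commutator[OF smooth_e p]
    by (simp add: null_trace_def mink_simps w_def[symmetric] van[OF V(2)])
  also have "mink (D 1 (e 2) p) (D 4 (e 4) p) - mink (D 4 (e 2) p) (D 1 (e 4) p) = - k p * l p"
    unfolding mink_expansion[OF p, of "D 1 (e 2) p" "D 4 (e 4) p"]
      mink_expansion[OF p, of "D 4 (e 2) p" "D 1 (e 4) p"]
    by (simp add: null_trace_def w_def[symmetric] h_def[symmetric] h_table[OF p] w_diag[OF p]
        w_swap[OF p] van[OF V(2)])
  finally show False using l[OF V(2)] k[OF V(2)] by simp
qed

text \<open>The case of a gradient along \<open>e4\<close>. The level sets of \<open>k\<close> are the integral manifolds of \<open>e1, e2, e3\<close>, and
  \<open>a = w 3 3 4\<close> is the only eigenvalue of their second fundamental form in the hypersurface. Along the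
  geodesics tangent to \<open>e4\<close> the functions \<open>k\<close> and \<open>a\<close> satisfy \<open>k' = 2 k a\<close> and the Riccati equation
  \<open>a' = a\<^sup>2 - k\<^sup>2\<close>. The divergence of \<open>e4\<close> being \<open>- 3 a\<close>, this determines
  \<open>box k = k'' - 3 a k' = - 2 k\<^sup>3\<close>, which is incompatible with the value \<open>4 k\<^sup>3\<close> of the normal
  equation.\<close>

lemma spacelike_gradient_impossible:
  assumes V: "chart_open V" "p \<in> V"
    and l: "\<And>q. q \<in> V \<Longrightarrow> l q = - k q"
    and k: "\<And>q. q \<in> V \<Longrightarrow> k q \<noteq> 0"
    and D1: "\<And>q. q \<in> V \<Longrightarrow> D 1 k q = 0"
    and D3: "\<And>q. q \<in> V \<Longrightarrow> D 3 k q = 0"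
    and D4: "\<And>q. q \<in> V \<Longrightarrow> D 4 k q \<noteq> 0"
    and box: "box k p = k p * (3 * (k p)\<^sup>2 + (l p)\<^sup>2)"
  shows False
proof -
  have D2: "D 2 k q = 0" if "q \<in> V" for q
    using codazzi_always[OF chart_open_subset[OF V(1) that]] by simp
  have zero: "D i (D 1 k) q = 0" "D i (D 2 k) q = 0" "D i (D 3 k) q = 0" if "q \<in> V" for i q
    by (rule D_locally_const[OF V(1) that], erule D1 D2 D3)+
  have con: "w 4 2 3 q = 0 \<and> w 1 2 4 q = - w 3 3 4 q \<and> w 2 1 4 q = - w 3 3 4 q \<and>
      w 2 3 4 q = 0 \<and> w 3 2 4 q = 0 \<and> w 4 1 4 q = 0 \<and> w 4 2 4 q = 0 \<and> w 4 3 4 q = 0 \<and>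
      D 4 k q = 2 * k q * w 3 3 4 q" if q: "q \<in> V" for q
  proof -
    note qc = chart_open_subset[OF V(1) q]
    have kl: "k q \<noteq> l q" "k q - l q = 2 * k q" using l[OF q] k[OF q] by auto
    note cod = codazzi_always[OF qc] codazzi_distinct[OF qc kl(1), unfolded kl(2)]
    have Dl: "D i l q = - D i k q" for i
    proof -
      have "D i l q = D i (\<lambda>q. - k q) q"
        by (rule D_cong[OF V(1) q]) (rule l)
      also have "\<dots> = - D i k q"
        by (rule D_minus[OF smooth_k qc])
      finally show ?thesis .
    qed
    have w42: "w 4 2 4 q = 0"
      using cod k[OF q] by (simp add: Dl)
    then have w43: "w 4 3 4 q = 0"
      using cod k[OF q] D3[OF q] by (simp add: Dl)
    then have w41: "w 4 1 4 q = 0"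
      using cod k[OF q] D1[OF q] by (simp add: Dl)
    \<comment> \<open>\<open>e1\<close> and \<open>e3\<close> are tangent to the level sets of \<open>k\<close>, and so is their bracket.\<close>
    have "w 1 3 4 q = w 3 1 4 q"
      using commutator[OF smooth_k qc, of 1 3] D4[OF q]
      by (simp add: zero[OF q] null_trace_def D1[OF q] D2[OF q] D3[OF q])
    then have w12: "w 1 2 4 q = - w 3 3 4 q"
      using cod(10) by simp
    moreover from this have "w 4 2 3 q = 0"
      using cod(7,8,9) by (simp add: algebra_simps)
    moreover from this have "D 4 k q = 2 * k q * w 3 3 4 q"
      using cod(9) by simp
    ultimately show ?thesis using cod w41 w42 w43 by simp
  qed
  note p = chart_open_subset[OF V]
  define a where "a = w 3 3 4 p"
  note con_p = con[OF V(2), folded a_def]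
  \<comment> \<open>The Gauss equation for \<open>\<langle>R(e4, e3) e4, e3\<rangle>\<close>, where \<open>D 4 (e 4)\<close> is normal.\<close>
  have riccati: "D 4 (w 3 3 4) p = a\<^sup>2 - (k p)\<^sup>2"
  proof -
    have "D 4 (w 3 4 3) p = D 4 (\<lambda>q. - w 3 3 4 q) p"
      by (rule D_cong_domain[OF p]) (rule w_swap)
    then have 1: "mink (D 4 (D 3 (e 4)) p) (e 3 p) = - D 4 (w 3 3 4) p - mink (D 3 (e 4) p) (D 4 (e 3) p)"
      by (simp add: w_def[of _ 4, abs_def] D_mink smooth_D smooth_e p D_minus smooth_w)
    have "D 3 (w 4 4 3) p = D 3 (\<lambda>q. 0::real) p"
      by (rule D_cong[OF V]) (simp add: w_swap[OF chart_open_subset[OF V(1)]] con)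
    then have 2: "mink (D 3 (D 4 (e 4)) p) (e 3 p) = - mink (D 4 (e 4) p) (D 3 (e 3) p)"
      by (simp add: w_def[abs_def] D_mink smooth_D smooth_e p D_const)
    have "mink (D 4 (D 3 (e 4)) p - D 3 (D 4 (e 4)) p) (e 3 p) = - a\<^sup>2"
      unfolding commutator[OF smooth_e p]
      by (simp add: null_trace_def mink_simps w_def[symmetric] con_p w_swap[OF p] w_diag[OF p]
          power2_eq_square a_def)
    moreover have "mink (D 3 (e 4) p) (D 4 (e 3) p) = 0" "mink (D 4 (e 4) p) (D 3 (e 3) p) = - (k p)\<^sup>2"
      unfolding mink_expansion[OF p, of "D 3 (e 4) p" "D 4 (e 3) p"]
        mink_expansion[OF p, of "D 4 (e 4) p" "D 3 (e 3) p"]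
      by (simp_all add: null_trace_def w_def[symmetric] h_def[symmetric] h_table[OF p] w_diag[OF p]
          w_swap[OF p] con_p l[OF V(2)] power2_eq_square)
    ultimately show ?thesis using 1 2 by (simp add: mink_simps)
  qed
  have "D 4 (D 4 k) p = D 4 (\<lambda>q. 2 * (k q * w 3 3 4 q)) p"
    by (rule D_cong[OF V]) (simp add: con)
  also have "\<dots> = 2 * (D 4 k p * a + k p * D 4 (w 3 3 4) p)"
    by (simp add: D_cmult D_mult smooth_mult smooth_k smooth_w p a_def)
  finally have DD: "D 4 (D 4 k) p = 2 * (D 4 k p * a + k p * D 4 (w 3 3 4) p)" .
  have "frame_div 4 p = - 3 * a"
    by (simp add: frame_div_def null_trace_def w_swap[OF p] w_diag[OF p] con_p a_def[symmetric])
  then have "box k p = D 4 (D 4 k) p - 3 * a * D 4 k p"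
    by (simp add: box_def null_trace_def zero V D1 D2 D3)
  also have "\<dots> = - 2 * (k p)^3"
    unfolding DD riccati using con_p by (simp add: algebra_simps power2_eq_square power3_eq_cube)
  finally have "- 2 * (k p)^3 = 4 * (k p)^3"
    using box l[OF V(2)] by (simp add: power2_eq_square power3_eq_cube)
  then show False using k[OF V(2)] by simp
qed

text \<open>The tangential equations say that the gradient of \<open>H\<close> is annihilated by \<open>2 S + H\<close>. Each of the two
  alternatives has to hold on an open set before it can be differentiated, so the neighbourhood is
  shrunk to where a nonvanishing function excludes the other alternative.\<close>

lemma biharmonic_imp_mean_curvature_zero:
  assumes biharm: "\<And>q. q \<in> fst c \<Longrightarrow> box (\<lambda>q. H q *\<^sub>R N q) q = 0" and p: "p \<in> fst c"
  shows "H p = 0"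
proof (rule ccontr)
  assume Hp: "H p \<noteq> 0"
  have normal: "box H q = H q * (3 * (k q)\<^sup>2 + (l q)\<^sup>2)" if "q \<in> fst c" for q
    using biharmonic_normal_tangential(1)[OF that biharm] that by (simp add: trace_shape_squared)
  have tang: "2 * (k q * D 1 H q - D 3 H q) + H q * D 1 H q = 0"
    "(2 * k q + H q) * D 2 H q = 0"
    "2 * (D 2 H q + k q * D 3 H q) + H q * D 3 H q = 0"
    "(2 * l q + H q) * D 4 H q = 0" if q: "q \<in> fst c" for q
    using biharmonic_normal_tangential(2)[OF q biharm, of 1] biharmonic_normal_tangential(2)[OF q biharm, of 2]
      biharmonic_normal_tangential(2)[OF q biharm, of 3] biharmonic_normal_tangential(2)[OF q biharm, of 4] q
    by (simp_all add: null_trace_def h_table algebra_simps)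
  define U where "U = {q \<in> fst c. H q \<noteq> 0}"
  have U: "chart_open U" "p \<in> U"
    using chart_open_nonzero[OF smooth_H chart_open_domain] p Hp by (auto simp: U_def)
  have "\<exists>q\<in>U. \<exists>i. D i H q \<noteq> 0"
  proof (rule ccontr)
    assume "\<not> ?thesis"
    then have const: "\<And>q i. q \<in> U \<Longrightarrow> D i H q = 0" by blast
    have "D i (D j H) p = 0" for i j
      by (rule D_locally_const[OF U]) (rule const)
    then have "box H p = 0"
      using const[OF U(2)] by (simp add: box_def null_trace_def)
    then have "k p = 0 \<and> l p = 0"
      using normal[OF p] Hp by (smt (verit) mult_eq_0_iff power2_less_0 zero_eq_power2)
    then show False using Hp H_eq[OF p] by simp
  qed
  then obtain q i where q: "q \<in> U" and i: "D i H q \<noteq> 0" by blast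
  define U' where "U' = {r \<in> U. D i H r \<noteq> 0}"
  have U': "chart_open U'" "q \<in> U'"
    using chart_open_nonzero[OF smooth_D[OF smooth_H] U(1), of i] q i by (auto simp: U'_def)
  show False
  proof (cases "2 * k q + H q = 0")
    case True
    define V where "V = {r \<in> U'. 2 * l r + H r \<noteq> 0}"
    \<comment> \<open>Otherwise \<open>k = l = - H / 2\<close>, hence \<open>H = 3 k + l = - 2 H\<close>.\<close>
    have "2 * l q + H q \<noteq> 0"
      using True q H_eq[of q] by (auto simp: U_def)
    then have V: "chart_open V" "q \<in> V"
      using chart_open_nonzero[OF smooth_add[OF smooth_mult[OF smooth_const smooth_l] smooth_H] U'(1), of 2]
        U'(2) by (auto simp: V_def)
    have on_V: "2 * k r + H r = 0 \<and> D 3 H r = 0 \<and> D 4 H r = 0 \<and> D 1 H r \<noteq> 0 \<and> H r \<noteq> 0"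
      if r: "r \<in> V" for r
    proof -
      have rc: "r \<in> fst c" and Dr: "D i H r \<noteq> 0" and Hr: "H r \<noteq> 0" and lr: "2 * l r + H r \<noteq> 0"
        using r unfolding V_def U'_def U_def by blast+
      have 4: "D 4 H r = 0" using tang(4)[OF rc] lr by simp
      have "2 * k r + H r = 0"
      proof (rule ccontr)
        assume nz: "2 * k r + H r \<noteq> 0"
        have "D 2 H r = 0" using tang(2)[OF rc] nz by simp
        moreover from this have "(2 * k r + H r) * D 3 H r = 0" using tang(3)[OF rc] by (simp add: algebra_simps)
        then have "D 3 H r = 0" using nz by simp
        moreover from this have "(2 * k r + H r) * D 1 H r = 0" using tang(1)[OF rc] by (simp add: algebra_simps)
        then have "D 1 H r = 0" using nz by simp
        ultimately show False using Dr 4 exhaust_4[of i] by auto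
      qed
      moreover from this have HH: "H r = - 2 * k r" by simp
      then have "D 3 H r = 0" "D 2 H r = 0" using tang(1,3)[OF rc] by (simp_all add: algebra_simps)
      ultimately show ?thesis using Dr Hr 4 exhaust_4[of i] by auto
    qed
    have DH: "D j H r = - 2 * D j k r" if r: "r \<in> V" for j r
    proof -
      have "D j H r = D j (\<lambda>s. - 2 * k s) r"
        by (rule D_cong[OF V(1) r]) (drule on_V, linarith)
      also have "\<dots> = - 2 * D j k r"
        by (rule D_cmult[OF smooth_k chart_open_subset[OF V(1) r]])
      finally show ?thesis .
    qed
    show False
    proof (rule null_gradient_impossible[OF V])
      fix r assume r: "r \<in> V"
      show "l r = - 5 * k r" "k r \<noteq> 0"
        using on_V[OF r] H_eq[OF chart_open_subset[OF V(1) r]] by auto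
      show "D 1 k r \<noteq> 0" "D 3 k r = 0" "D 4 k r = 0"
        using on_V[OF r] DH[OF r] by auto
    qed
  next
    case False
    define V where "V = {r \<in> U'. 2 * k r + H r \<noteq> 0}"
    have V: "chart_open V" "q \<in> V"
      using chart_open_nonzero[OF smooth_add[OF smooth_mult[OF smooth_const smooth_k] smooth_H] U'(1), of 2]
        U'(2) False by (auto simp: V_def)
    have on_V: "2 * l r + H r = 0 \<and> D 1 H r = 0 \<and> D 3 H r = 0 \<and> D 4 H r \<noteq> 0 \<and> H r \<noteq> 0"
      if r: "r \<in> V" for r
    proof -
      have rc: "r \<in> fst c" and Dr: "D i H r \<noteq> 0" and Hr: "H r \<noteq> 0" and nz: "2 * k r + H r \<noteq> 0"
        using r unfolding V_def U'_def U_def by blast+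
      have 2: "D 2 H r = 0" using tang(2)[OF rc] nz by simp
      then have "(2 * k r + H r) * D 3 H r = 0" using tang(3)[OF rc] by (simp add: algebra_simps)
      then have 3: "D 3 H r = 0" using nz by simp
      then have "(2 * k r + H r) * D 1 H r = 0" using tang(1)[OF rc] by (simp add: algebra_simps)
      then have 1: "D 1 H r = 0" using nz by simp
      have "D 4 H r \<noteq> 0" using Dr 1 2 3 exhaust_4[of i] by auto
      then show ?thesis using 1 3 Hr tang(4)[OF rc] by simp
    qed
    have Hk: "H r = 2 * k r \<and> l r = - k r" if r: "r \<in> V" for r
      using on_V[OF r] H_eq[OF chart_open_subset[OF V(1) r]] by auto
    have DH: "D j H r = 2 * D j k r" if r: "r \<in> V" for j r
    proof -
      have "D j H r = D j (\<lambda>s. 2 * k s) r"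
        by (rule D_cong[OF V(1) r]) (use Hk in auto)
      also have "\<dots> = 2 * D j k r"
        by (rule D_cmult[OF smooth_k chart_open_subset[OF V(1) r]])
      finally show ?thesis .
    qed
    have "D j (D m H) q = 2 * D j (D m k) q" for j m
    proof -
      have "D j (D m H) q = D j (\<lambda>r. 2 * D m k r) q"
        by (rule D_cong[OF V]) (rule DH)
      also have "\<dots> = 2 * D j (D m k) q"
        by (rule D_cmult[OF smooth_D[OF smooth_k] chart_open_subset[OF V]])
      finally show ?thesis .
    qed
    then have "box H q = 2 * box k q"
      by (simp add: box_def null_trace_def DH[OF V(2)] algebra_simps)
    show False
    proof (rule spacelike_gradient_impossible[OF V])
      show "box k q = k q * (3 * (k q)\<^sup>2 + (l q)\<^sup>2)"
        using \<open>box H q = 2 * box k q\<close> normal[OF chart_open_subset[OF V]] Hk[OF V(2)] by simp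
      fix r assume r: "r \<in> V"
      show "l r = - k r" "k r \<noteq> 0" "D 1 k r = 0" "D 3 k r = 0" "D 4 k r \<noteq> 0"
        using on_V[OF r] DH[OF r] Hk[OF r] by auto
    qed
  qed
qed

end

theorem theorem3p3:
  fixes X :: "'m topology" and A :: "'m chart set"
    and x N :: "'m \<Rightarrow> real^5" and e :: "4 \<Rightarrow> 'm \<Rightarrow> real^5" and k1 k4 :: "'m \<Rightarrow> real"
  assumes "lorentzian_hypersurface X A x"
    and "unit_normal_field A x N"
    and "pseudo_orthonormal_frame A x e"
    and "smooth_map A k1" and "smooth_map A k4"
    and "\<And>c p. c \<in> A \<Longrightarrow> p \<in> fst c \<Longrightarrow>
           shape_operator c x N p (e 1 p) = k1 p *\<^sub>R e 1 p - e 3 p \<and>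
           shape_operator c x N p (e 2 p) = k1 p *\<^sub>R e 2 p \<and>
           shape_operator c x N p (e 3 p) = e 2 p + k1 p *\<^sub>R e 3 p \<and>
           shape_operator c x N p (e 4 p) = k4 p *\<^sub>R e 4 p"
  shows "biharmonic A x \<longleftrightarrow> minimal_hypersurface A x N"
proof -
  have chart: "nilpotent_block_chart c x N e k1 k4" if c: "c \<in> A" for c
  proof -
    have ch: "is_chart X c" "\<And>f::'m \<Rightarrow> real^5. smooth_map A f \<Longrightarrow> smooth_on (in_chart c f) (snd c ` fst c)"
      "\<And>f::'m \<Rightarrow> real. smooth_map A f \<Longrightarrow> smooth_on (in_chart c f) (snd c ` fst c)"
      using assms(1) c by (auto simp: lorentzian_hypersurface_def connected_oriented_manifold_def
          oriented_atlas_def smooth_map_def)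
    have sub: "fst c \<subseteq> topspace X"
      using ch(1) by (auto simp: is_chart_def dest: openin_subset)
    interpret smooth_chart c
    proof
      show "open (snd c ` fst c)" using ch(1) by (simp add: is_chart_def)
      show "inj_on (snd c) (fst c)"
        using ch(1) sub by (auto simp: is_chart_def dest!: homeomorphic_imp_injective_map)
          (simp add: Int_absorb1)
    qed
    have frame: "mink (e i p) (e j p) = gram i j" if p: "p \<in> fst c" for i j p
    proof -
      have *: "mink (e 1 p) (e 1 p) = 0 \<and> mink (e 2 p) (e 2 p) = 0 \<and> mink (e 1 p) (e 2 p) = -1 \<and>
        (\<forall>a\<in>{1,2}. \<forall>b\<in>{3,4}. mink (e a p) (e b p) = 0) \<and>
        (\<forall>a\<in>{3,4}. \<forall>b\<in>{3,4}. mink (e a p) (e b p) = (if a = b then 1 else 0))"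
        using assms(3) c p unfolding pseudo_orthonormal_frame_def by blast
      then have "mink (e 2 p) (e 1 p) = -1" "\<forall>a\<in>{1,2}. \<forall>b\<in>{3,4}. mink (e b p) (e a p) = 0"
        by (metis mink_commute)+
      with * show ?thesis
        using exhaust_4[of i] exhaust_4[of j] by auto
    qed
    have "smooth_map A x" and imm: "\<And>p. p \<in> fst c \<Longrightarrow> inj (differential c x p)"
      using assms(1) c by (auto simp: lorentzian_hypersurface_def)
    moreover have "smooth_map A N"
      and unit: "\<And>p. p \<in> fst c \<Longrightarrow> mink (N p) (N p) = 1"
      and tan: "\<And>p v. p \<in> fst c \<Longrightarrow> mink (N p) (differential c x p v) = 0"
      using assms(2) c by (auto simp: unit_normal_field_def tangent_space_def)
    moreover have "\<And>i. smooth_map A (e i)" and et: "\<And>p i. p \<in> fst c \<Longrightarrow> e i p \<in> tangent_space c x p"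
      using assms(3) c by (auto simp: pseudo_orthonormal_frame_def)
    ultimately show ?thesis
      using assms(4,5) assms(6)[OF c]
      by unfold_locales (auto simp: smooth_def ch frame)
  qed
  show ?thesis
  proof
    assume biharm: "biharmonic A x"
    show "minimal_hypersurface A x N"
      unfolding minimal_hypersurface_def
    proof (intro ballI)
      fix c p assume c: "c \<in> A" and p: "p \<in> fst c"
      interpret nilpotent_block_chart c x N e k1 k4 by (rule chart[OF c])
      have "box (\<lambda>q. H q *\<^sub>R N q) q = 0" if q: "q \<in> fst c" for q
        using biharm c q by (simp add: biharmonic_def vec_eq_iff flip: bilaplacian_immersion[OF q])
      then show "mean_curvature c x N p = 0"
        using biharmonic_imp_mean_curvature_zero[OF _ p] by (simp add: mean_curvature_null_frame[OF p])
    qed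
  next
    assume minimal: "minimal_hypersurface A x N"
    show "biharmonic A x"
      unfolding biharmonic_def
    proof (intro ballI allI)
      fix c p a assume c: "c \<in> A" and p: "p \<in> fst c"
      interpret nilpotent_block_chart c x N e k1 k4 by (rule chart[OF c])
      have H0: "H q = 0" if "q \<in> fst c" for q
        using minimal c that by (simp add: minimal_hypersurface_def flip: mean_curvature_null_frame)
      have "laplacian c x (laplacian c x (\<lambda>q. x q $ a)) p = laplacian c x (\<lambda>q. 0) p"
        by (rule laplacian_cong[OF _ smooth_const p]) (simp add: laplacian_immersion H0)
      also have "\<dots> = 0"
        by (simp add: laplacian_null_frame[OF smooth_const p] box_def D_const[abs_def] null_trace_def)
      finally show "laplacian c x (laplacian c x (\<lambda>q. x q $ a)) p = 0" .
    qed
  qed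
qed

end
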